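(* Let $\Gamma$ be a minimal weighted graph. Then the following hold. (a) If $\Gamma$ is not reduced to a point (i.e. $\Gamma$ is not a one-vertex linear chain $[[w]]$), then $\Gamma$ admits an inner transformation into a semistandard graph, i.e. it can be transformed into a semistandard graph by a finite sequence of admissible blowdowns and inner blowups. (b) $\Gamma$ can be transformed by an admissible transformation into a standard graph.
   Context: Weighted graphs. A graph is finite, with a nonempty set of vertices and a set of edges, each edge having one or two end points (an edge with one end point is a loop; loops and multiple edges are allowed). Every vertex $v$ carries an integer weight $v^2$. All graphs are assumed connected. The degree $\deg(v)$ is the number of edges at $v$, loops counted twice. A vertex is a branching point if $\deg(v)>2$, linear if $\deg(v)=2$, an end vertex if $\deg(v)\le 1$. $B(\Gamma)$ is the set of branching points; the total branching number is $\nu(\Gamma)=\sum_{v\in B(\Gamma)}(\deg(v)-2)$. A linear chain with consecutive vertices of weights $w_0,\dots,w_n$ is denoted $[[w_0,\dots,w_n]]$ (a path graph; a one-vertex chain has no edges). A circular graph is a connected graph all of whose vertices are linear; with cyclically ordered weights $w_0,\dots,w_n$ it is denoted $((w_0,\dots,w_n))$ (so $((w))$ is one vertex with a loop, and $((w_0,w_1))$ is two vertices joined by two edges). Inside these brackets $0_m$ denotes $m$ consecutive entries $0$. The segments of $\Gamma$ are the connected components of the graph $\Gamma\ominus B(\Gamma)$ obtained by deleting all branching points and their incident edges; each is a linear chain or a circular graph. Blowups. An inner blowup at an edge $e$ with end points $v_0,v_1$ subdivides $e$ by a new vertex of weight $-1$ and decreases the weights of $v_0$ and $v_1$ by $1$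 (if $e$ is a loop, $v_0=v_1$, the weight of $v_0$ decreases by $2$). An outer blowup at a vertex $v_0$ adds a new vertex of weight $-1$ joined to $v_0$ by one new edge and decreases the weight of $v_0$ by $1$. The inverse operations are blowdowns. The one-vertex chain $[[-1]]$ is also regarded as admitting a blowdown (to the empty graph). A graph is minimal if it admits no blowdown. A birational transformation is a finite sequence of blowups and blowdowns. It is admissible if the total branching number stays constant at every step (a single blowup or blowdown is admissible if it does not change $\nu$). An admissible transformation is inner if each of its steps is either an admissible blowdown or an inner blowup. Standard graphs. A non-circular graph is standard if each of its nonempty segments is (for a suitable orientation) one of the linear chains $[[0_{2k},w_1,\dots,w_n]]$ or $[[0_{2k+1}]]$ with $k,n\ge 0$ and all $w_i\le -2$. A circular graph is standard if it is one of $((0_{2k},w_1,\dots,w_n))$, $((0_l,w))$, $((0_{2k},-1,-1))$ with $k,l\ge 0$, $n>0$, $w\le 0$ and $w_1,\dots,w_n\le -2$. A graph is semistandard if each of its nonempty segments is either a standard circular graph or (for a suitable orientation) one of the linear chains $[[0_l,w_1,\dots,w_n]]$ or $[[0_l,w_1,\dots,w_n,0]]$ with $l,n\ge 0$ and all $w_i\le -2$. *)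

theory Defs
  imports "HOL-Library.Multiset" "HOL-Library.Infinite_Typeclass"
begin

(* An undirected multigraph is given by its vertices and by the multiset of the end point sets of
   its edges: {a, b} with a \<noteq> b is an edge joining a and b, the singleton {a} is a loop at a, and
   multiplicities account for multiple edges. Weights are only meaningful on vertices. *)
record 'v wgraph =
  verts :: "'v set"
  edges :: "'v set multiset"
  weight :: "'v \<Rightarrow> int"

definition adjacent :: "'v wgraph \<Rightarrow> 'v \<Rightarrow> 'v \<Rightarrow> bool" where
  "adjacent G u v \<longleftrightarrow> {u, v} \<in># edges G"

definition connected_graph :: "'v wgraph \<Rightarrow> bool" where
  "connected_graph G \<longleftrightarrow> (\<forall>u\<in>verts G. \<forall>v\<in>verts G. (adjacent G)\<^sup>*\<^sup>* u v)"

definition weighted_graph :: "'v wgraph \<Rightarrow> bool" where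
  "weighted_graph G \<longleftrightarrow>
     finite (verts G) \<and> verts G \<noteq> {} \<and>
     (\<forall>e. e \<in># edges G \<longrightarrow> e \<subseteq> verts G \<and> card e \<in> {1, 2}) \<and>
     connected_graph G"

(* The second summand makes loops count twice. *)
definition deg :: "'v wgraph \<Rightarrow> 'v \<Rightarrow> nat" where
  "deg G v = size {#e \<in># edges G. v \<in> e#} + size {#e \<in># edges G. e = {v}#}"

definition branching_points :: "'v wgraph \<Rightarrow> 'v set" where
  "branching_points G = {v \<in> verts G. deg G v > 2}"

definition total_branching :: "'v wgraph \<Rightarrow> nat" where
  "total_branching G = (\<Sum>v\<in>branching_points G. deg G v - 2)"

definition delete_verts :: "'v wgraph \<Rightarrow> 'v set \<Rightarrow> 'v wgraph" where
  "delete_verts G S =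
     \<lparr>verts = verts G - S, edges = {#e \<in># edges G. e \<inter> S = {}#}, weight = weight G\<rparr>"

definition component :: "'v wgraph \<Rightarrow> 'v \<Rightarrow> 'v wgraph" where
  "component G v = delete_verts G {u \<in> verts G. \<not> (adjacent G)\<^sup>*\<^sup>* v u}"

definition components :: "'v wgraph \<Rightarrow> 'v wgraph set" where
  "components G = component G ` verts G"

(* Components have at least one vertex, so all members of this set are nonempty segments. *)
definition segments :: "'v wgraph \<Rightarrow> 'v wgraph set" where
  "segments G = components (delete_verts G (branching_points G))"

(* The chain [[ws]]. The orientation is free, as the vertices may be listed in either direction. *)
definition is_chain :: "'v wgraph \<Rightarrow> int list \<Rightarrow> bool" where
  "is_chain G ws \<longleftrightarrow>
     (\<exists>vs. vs \<noteq> [] \<and> distinct vs \<and> set vs = verts G \<and>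
           edges G = mset (map2 (\<lambda>a b. {a, b}) vs (tl vs)) \<and> map (weight G) vs = ws)"

definition circular_graph :: "'v wgraph \<Rightarrow> bool" where
  "circular_graph G \<longleftrightarrow> weighted_graph G \<and> (\<forall>v\<in>verts G. deg G v = 2)"

(* The circular graph ((ws)). For one vertex the edge multiset is a single loop, for two vertices
   it is a double edge. *)
definition is_circle :: "'v wgraph \<Rightarrow> int list \<Rightarrow> bool" where
  "is_circle G ws \<longleftrightarrow>
     (\<exists>vs. vs \<noteq> [] \<and> distinct vs \<and> set vs = verts G \<and>
           edges G = mset (map2 (\<lambda>a b. {a, b}) vs (rotate1 vs)) \<and> map (weight G) vs = ws)"

(* The end points v0 and v1 coincide if the edge is a loop; then its weight drops by 2. *)
definition inner_blowup :: "'v wgraph \<Rightarrow> 'v wgraph \<Rightarrow> bool" where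
  "inner_blowup G G' \<longleftrightarrow> weighted_graph G \<and>
     (\<exists>v0 v1 E v. edges G = add_mset {v0, v1} E \<and> v \<notin> verts G \<and>
        verts G' = insert v (verts G) \<and>
        edges G' = add_mset {v0, v} (add_mset {v, v1} E) \<and>
        weight G' v = -1 \<and>
        (\<forall>u\<in>verts G. weight G' u = weight G u - of_bool (u = v0) - of_bool (u = v1)))"

definition outer_blowup :: "'v wgraph \<Rightarrow> 'v wgraph \<Rightarrow> bool" where
  "outer_blowup G G' \<longleftrightarrow> weighted_graph G \<and>
     (\<exists>v0 v. v0 \<in> verts G \<and> v \<notin> verts G \<and>
        verts G' = insert v (verts G) \<and>
        edges G' = add_mset {v0, v} (edges G) \<and>
        weight G' v = -1 \<and>
        (\<forall>u\<in>verts G. weight G' u = weight G u - of_bool (u = v0)))"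

definition blowup :: "'v wgraph \<Rightarrow> 'v wgraph \<Rightarrow> bool" where
  "blowup G G' \<longleftrightarrow> inner_blowup G G' \<or> outer_blowup G G'"

(* The second disjunct is the blowdown of [[-1]] to the empty graph, which is not a weighted graph
   in the sense above and from which no further step is possible. *)
definition blowdown :: "'v wgraph \<Rightarrow> 'v wgraph \<Rightarrow> bool" where
  "blowdown G G' \<longleftrightarrow> blowup G' G \<or> (is_chain G [-1] \<and> verts G' = {} \<and> edges G' = {#})"

definition minimal_graph :: "'v wgraph \<Rightarrow> bool" where
  "minimal_graph G \<longleftrightarrow> (\<nexists>G'. blowdown G G')"

definition admissible_step :: "'v wgraph \<Rightarrow> 'v wgraph \<Rightarrow> bool" where
  "admissible_step G G' \<longleftrightarrow>
     (blowup G G' \<or> blowdown G G') \<and> total_branching G' = total_branching G"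

definition inner_step :: "'v wgraph \<Rightarrow> 'v wgraph \<Rightarrow> bool" where
  "inner_step G G' \<longleftrightarrow> admissible_step G G' \<and> (blowdown G G' \<or> inner_blowup G G')"

definition admissible_transformation :: "'v wgraph \<Rightarrow> 'v wgraph \<Rightarrow> bool" where
  "admissible_transformation = admissible_step\<^sup>*\<^sup>*"

definition inner_transformation :: "'v wgraph \<Rightarrow> 'v wgraph \<Rightarrow> bool" where
  "inner_transformation = inner_step\<^sup>*\<^sup>*"

definition zeros :: "nat \<Rightarrow> int list" where
  "zeros m = replicate m 0"

definition standard_chain :: "'v wgraph \<Rightarrow> bool" where
  "standard_chain G \<longleftrightarrow>
     (\<exists>k ws. (\<forall>w\<in>set ws. w \<le> -2) \<and> is_chain G (zeros (2 * k) @ ws)) \<or>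
     (\<exists>k. is_chain G (zeros (2 * k + 1)))"

definition standard_circular :: "'v wgraph \<Rightarrow> bool" where
  "standard_circular G \<longleftrightarrow>
     (\<exists>k ws. ws \<noteq> [] \<and> (\<forall>w\<in>set ws. w \<le> -2) \<and> is_circle G (zeros (2 * k) @ ws)) \<or>
     (\<exists>l w. w \<le> 0 \<and> is_circle G (zeros l @ [w])) \<or>
     (\<exists>k. is_circle G (zeros (2 * k) @ [-1, -1]))"

definition semistandard_chain :: "'v wgraph \<Rightarrow> bool" where
  "semistandard_chain G \<longleftrightarrow>
     (\<exists>l ws. (\<forall>w\<in>set ws. w \<le> -2) \<and>
             (is_chain G (zeros l @ ws) \<or> is_chain G (zeros l @ ws @ [0])))"

definition standard_graph :: "'v wgraph \<Rightarrow> bool" where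
  "standard_graph G \<longleftrightarrow> weighted_graph G \<and>
     (if circular_graph G then standard_circular G else (\<forall>S\<in>segments G. standard_chain S))"

definition semistandard_graph :: "'v wgraph \<Rightarrow> bool" where
  "semistandard_graph G \<longleftrightarrow> weighted_graph G \<and>
     (\<forall>S\<in>segments G. standard_circular S \<or> semistandard_chain S)"

end

theory Submission
  imports Defs
begin

text \<open>
  Branching points survive every step used here, so the segments can be treated one at a time and
  the problem becomes one about rewriting lists of weights. The basic move is
  \<open>[a, 0, b] \<rightarrow> [a - k, 0, b + k]\<close>. It lets pairs of zeros pass any weight, and turns
  \<open>[a, 0, b]\<close> into \<open>[0, 0, a + b]\<close>. A positive weight is blown up to \<open>0\<close> and then absorbed in
  this way, a weight \<open>-1\<close> is contracted. For a linear segment one normalizes the weights from left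
  to right behind a block of zeros, which exists as soon as some weight is nonnegative; the other
  segments of a minimal graph have all weights \<open>\<le> -2\<close>. For a circular graph each absorption
  lowers the number of nonnegative weights.
\<close>

section \<open>Rewriting linear chains of weights\<close>

text \<open>Segments can be treated independently because neither normal form constrains the weight
  of a branching point: a blowup of the edge leading to it may change that weight at will, and so
  acts as a move beyond the end of the segment. The two claims differ at free ends. There a blowup
  beyond the end is an outer one, which is admissible but not inner. Without it, a weight next to an
  end zero can still be lowered, by blowing up the edge between them and contracting the old end
  vertex; raising that weight needs the move beyond the end. Lowering alone leads from a zero at an
  end to the semistandard form, with a block of zeros of either parity and possibly one more zero at
  the other end. Raising a weight to 0 then repairs the parity and removes the extra zero, which
  gives the standard form. A one-vertex chain has no edge to blow up, so it is the case in which a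
  positive weight cannot be brought to 0 by inner steps; this is the exception in the first
  claim.\<close>

inductive mid_step :: "int list \<Rightarrow> int list \<Rightarrow> bool" where
  up: "mid_step (u @ [a, b] @ v) (u @ [a - 1, -1, b - 1] @ v)"
| down: "mid_step (u @ [a, -1, b] @ v) (u @ [a + 1, b + 1] @ v)"

text \<open>The flags say whether a blowup beyond the left, respectively right, end is allowed: the inner
  blowup of the edge to a branching point or the outer blowup at a free end, which have the same
  effect on the weights of the segment.\<close>

inductive chain_step :: "bool \<Rightarrow> bool \<Rightarrow> int list \<Rightarrow> int list \<Rightarrow> bool" for pl pr where
  mid: "mid_step xs ys \<Longrightarrow> chain_step pl pr xs ys"
| left_up: "pl \<Longrightarrow> chain_step pl pr (b # v) (-1 # (b - 1) # v)"
| left_down: "chain_step pl pr (-1 # b # v) ((b + 1) # v)"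
| right_up: "pr \<Longrightarrow> chain_step pl pr (v @ [b]) (v @ [b - 1, -1])"
| right_down: "chain_step pl pr (v @ [b, -1]) (v @ [b + 1])"

text \<open>A circle is a list up to rotation, so \<open>rot\<close> only relists the vertices of
  one graph. The two loop rules connect the one-vertex circle with the two-vertex circle, where both
  ends of the edge are the same vertex and its weight changes by 2.\<close>

inductive circle_step :: "int list \<Rightarrow> int list \<Rightarrow> bool" where
  mid: "mid_step xs ys \<Longrightarrow> circle_step xs ys"
| rot: "circle_step (x # xs) (xs @ [x])"
| loop_up: "circle_step [a] [a - 2, -1]"
| loop_down: "circle_step [a, -1] [a + 2]"

lemma rtranclp_two_steps: "R x y \<Longrightarrow> R y z \<Longrightarrow> R\<^sup>*\<^sup>* x z"
  by (rule converse_rtranclp_into_rtranclp[OF _ r_into_rtranclp])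

text \<open>Closure under context is what lets one relation of interior moves serve both chains and
  circles.\<close>

lemma mid_step_append: "mid_step xs ys \<Longrightarrow> mid_step (p @ xs @ q) (p @ ys @ q)"
proof (induction rule: mid_step.induct)
  case (up u a b v)
  show ?case using mid_step.up[of "p @ u" a b "v @ q"] by simp
next
  case (down u a b v)
  show ?case using mid_step.down[of "p @ u" a b "v @ q"] by simp
qed

lemma mid_steps_append: "mid_step\<^sup>*\<^sup>* xs ys \<Longrightarrow> mid_step\<^sup>*\<^sup>* (p @ xs @ q) (p @ ys @ q)"
proof (induction rule: rtranclp_induct)
  case (step y z)
  then show ?case by (blast intro: mid_step_append rtranclp.rtrancl_into_rtrancl)
qed simp

lemma mid_step_rev: "mid_step xs ys \<Longrightarrow> mid_step (rev xs) (rev ys)"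
proof (induction rule: mid_step.induct)
  case (up u a b v)
  show ?case using mid_step.up[of "rev v" b a "rev u"] by simp
next
  case (down u a b v)
  show ?case using mid_step.down[of "rev v" b a "rev u"] by simp
qed

lemma mid_steps_rev: "mid_step\<^sup>*\<^sup>* xs ys \<Longrightarrow> mid_step\<^sup>*\<^sup>* (rev xs) (rev ys)"
proof (induction rule: rtranclp_induct)
  case (step y z)
  then show ?case by (blast intro: mid_step_rev rtranclp.rtrancl_into_rtrancl)
qed simp

lemma chain_step_rev: "chain_step pl pr xs ys \<Longrightarrow> chain_step pr pl (rev xs) (rev ys)"
proof (induction rule: chain_step.induct)
  case (mid xs ys)
  then show ?case by (intro chain_step.mid mid_step_rev)
next
  case (left_up b v)
  then show ?case using chain_step.right_up[of pl pr "rev v" b] by simp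
next
  case (left_down b v)
  then show ?case using chain_step.right_down[of pr pl "rev v" b] by simp
next
  case (right_up v b)
  then show ?case using chain_step.left_up[of pr pl b "rev v"] by simp
next
  case (right_down v b)
  then show ?case using chain_step.left_down[of pr pl b "rev v"] by simp
qed

lemma chain_steps_rev: "(chain_step pl pr)\<^sup>*\<^sup>* xs ys \<Longrightarrow> (chain_step pr pl)\<^sup>*\<^sup>* (rev xs) (rev ys)"
proof (induction rule: rtranclp_induct)
  case (step y z)
  then show ?case by (blast intro: chain_step_rev rtranclp.rtrancl_into_rtrancl)
qed simp

lemma mid_steps_chain: "mid_step\<^sup>*\<^sup>* xs ys \<Longrightarrow> (chain_step pl pr)\<^sup>*\<^sup>* (p @ xs @ q) (p @ ys @ q)"
  by (rule rtranclp_mono[THEN predicate2D, OF _ mid_steps_append]) (auto intro: chain_step.mid)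

lemma mid_steps_circle: "mid_step\<^sup>*\<^sup>* xs ys \<Longrightarrow> circle_step\<^sup>*\<^sup>* (p @ xs @ q) (p @ ys @ q)"
  by (rule rtranclp_mono[THEN predicate2D, OF _ mid_steps_append]) (auto intro: circle_step.mid)

text \<open>Blowing up one edge at a 0-vertex and contracting the old 0-vertex shifts weight across it.\<close>

lemma shift_one: "mid_step\<^sup>*\<^sup>* [a, 0, b] [a - 1, 0, b + 1]"
proof -
  have "mid_step [a, 0, b] [a - 1, -1, -1, b]" using mid_step.up[of "[]" a 0 "[b]"] by simp
  moreover have "mid_step [a - 1, -1, -1, b] [a - 1, 0, b + 1]"
    using mid_step.down[of "[a - 1]" "-1" b "[]"] by simp
  ultimately show ?thesis by (rule rtranclp_two_steps)
qed

lemma shift_nat: "mid_step\<^sup>*\<^sup>* [a, 0, b] [a - int n, 0, b + int n]"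
proof (induction n)
  case (Suc n)
  then show ?case using shift_one[of "a - int n" "b + int n"] by (simp add: algebra_simps)
qed simp

lemma shift: "mid_step\<^sup>*\<^sup>* [a, 0, b] [a - k, 0, b + k]"
proof (cases "k \<ge> 0")
  case True
  then show ?thesis using shift_nat[of a b "nat k"] by simp
next
  case False
  then show ?thesis using mid_steps_rev[OF shift_nat[of b a "nat (-k)"]] by simp
qed

section \<open>Moving zeros and changing the weights next to them\<close>

lemma zeros_Suc: "zeros (Suc n) = 0 # zeros n" and zeros_0: "zeros 0 = []"
  by (auto simp: zeros_def)

lemma zeros_add: "zeros (m + n) = zeros m @ zeros n"
  by (simp add: zeros_def replicate_add)

lemma zeros_snoc: "zeros n @ 0 # xs = 0 # zeros n @ xs"
  by (induction n) (auto simp: zeros_def)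

lemma rev_zeros: "rev (zeros n) = zeros n"
  by (simp add: zeros_def)

lemma zeros_even_right: "mid_step\<^sup>*\<^sup>* (zeros (2 * k) @ [c]) (c # zeros (2 * k))"
proof (induction k)
  case (Suc k)
  have "mid_step\<^sup>*\<^sup>* ([0, 0] @ (zeros (2 * k) @ [c]) @ []) ([0, 0] @ (c # zeros (2 * k)) @ [])"
    using Suc mid_steps_append by blast
  moreover have "mid_step\<^sup>*\<^sup>* ([] @ [0, 0, c] @ zeros (2 * k)) ([] @ [c, 0, 0] @ zeros (2 * k))"
    \<comment> \<open>The second zero is the pivot: shifting by \<open>-c\<close> carries all of
      \<open>c\<close> to the place of the first zero and leaves 0 behind.\<close>
    using shift[of 0 c "-c"] by (intro mid_steps_append) simp
  ultimately show ?case by (simp add: zeros_Suc)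
qed (simp add: zeros_0)

lemma zeros_even_left: "mid_step\<^sup>*\<^sup>* (c # zeros (2 * k)) (zeros (2 * k) @ [c])"
  using mid_steps_rev[OF zeros_even_right[of k c]] by (simp add: rev_zeros)

lemma zeros_even_left_list: "mid_step\<^sup>*\<^sup>* (xs @ zeros (2 * k)) (zeros (2 * k) @ xs)"
proof (induction xs)
  case (Cons x xs)
  have "mid_step\<^sup>*\<^sup>* ([x] @ (xs @ zeros (2 * k)) @ []) ([x] @ (zeros (2 * k) @ xs) @ [])"
    using Cons mid_steps_append by blast
  moreover have "mid_step\<^sup>*\<^sup>* ([] @ (x # zeros (2 * k)) @ xs) ([] @ (zeros (2 * k) @ [x]) @ xs)"
    using zeros_even_left mid_steps_append by blast
  ultimately show ?case by simp
qed simp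

text \<open>Every blowup after the first takes the edge between the newest vertex and
  \<open>b\<close>: the newest vertex drops from -1 to -2, \<open>b\<close> loses one, and
  \<open>a\<close> pays only for the first blowup. After \<open>b\<close> blowups the weight
  \<open>b\<close> has become 0.\<close>

lemma blow_left:
  "mid_step\<^sup>*\<^sup>* [a, b] ((a - 1) # replicate n (-2) @ [-1, b - int (Suc n)])"
proof (induction n)
  case 0
  show ?case using mid_step.up[of "[]" a b "[]"] by auto
next
  case (Suc n)
  have "mid_step ((a - 1) # replicate n (-2) @ [-1, b - int (Suc n)])
     ((a - 1) # replicate n (-2) @ [-1 - 1, -1, b - int (Suc n) - 1])"
    using mid_step.up[of "(a - 1) # replicate n (-2)" "-1" "b - int (Suc n)" "[]"] by simp
  moreover have "(a - 1) # replicate n (-2) @ [-1 - 1, -1, b - int (Suc n) - 1]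
    = (a - 1) # replicate (Suc n) (-2) @ [-1, b - int (Suc (Suc n))]"
    by (simp add: replicate_append_same[symmetric])
  ultimately show ?case using Suc by (metis rtranclp.rtrancl_into_rtrancl)
qed

lemma blow_left_zero: "b \<ge> 1 \<Longrightarrow> mid_step\<^sup>*\<^sup>* [a, b] ((a - 1) # replicate (nat b - 1) (-2) @ [-1, 0])"
  using blow_left[of a b "nat b - 1"] by simp

lemma blow_right_zero: "b \<ge> 1 \<Longrightarrow> mid_step\<^sup>*\<^sup>* [b, a] ([0, -1] @ replicate (nat b - 1) (-2) @ [a - 1])"
  using mid_steps_rev[OF blow_left_zero[of b a]] by simp

text \<open>The edge of \<open>[0, z]\<close> is blown up to \<open>[-1, -1, z - 1]\<close> and the
  old end vertex is contracted, so that the new vertex becomes the end zero. There is no blowup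
  beyond the end, hence no condition on the flags.\<close>

lemma left_zero_decrease: "y \<le> x \<Longrightarrow> (chain_step pl pr)\<^sup>*\<^sup>* (0 # x # v) (0 # y # v)"
proof -
  have one: "(chain_step pl pr)\<^sup>*\<^sup>* (0 # z # v) (0 # (z - 1) # v)" for z
  proof -
    have "chain_step pl pr (0 # z # v) (-1 # -1 # (z - 1) # v)"
      using mid_step.up[of "[]" 0 z v] chain_step.mid by fastforce
    moreover have "chain_step pl pr (-1 # -1 # (z - 1) # v) (0 # (z - 1) # v)"
      using chain_step.left_down[of pl pr "-1" "(z - 1) # v"] by simp
    ultimately show ?thesis by (rule rtranclp_two_steps)
  qed
  have "(chain_step pl pr)\<^sup>*\<^sup>* (0 # x # v) (0 # (x - int n) # v)" for n
  proof (induction n)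
    case (Suc n)
    then show ?case using one[of "x - int n"] by (simp add: algebra_simps)
  qed simp
  from this[of "nat (x - y)"] show "y \<le> x \<Longrightarrow> ?thesis" by simp
qed

text \<open>The opposite move: a blowup beyond the end gives \<open>[-1, -1, z]\<close>, and
  contracting the former end zero raises \<open>z\<close>. This is where \<open>pl\<close> is
  needed.\<close>

lemma left_zero_increase: "pl \<Longrightarrow> x \<le> y \<Longrightarrow> (chain_step pl pr)\<^sup>*\<^sup>* (0 # x # v) (0 # y # v)"
proof -
  assume pl: "pl"
  have one: "(chain_step pl pr)\<^sup>*\<^sup>* (0 # z # v) (0 # (z + 1) # v)" for z
  proof -
    have "chain_step pl pr (0 # z # v) (-1 # -1 # z # v)"
      using chain_step.left_up[of pl pr 0 "z # v"] pl by simp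
    moreover have "chain_step pl pr (-1 # -1 # z # v) (0 # (z + 1) # v)"
      using mid_step.down[of "[]" "-1" z v] chain_step.mid by fastforce
    ultimately show ?thesis by (rule rtranclp_two_steps)
  qed
  have "(chain_step pl pr)\<^sup>*\<^sup>* (0 # x # v) (0 # (x + int n) # v)" for n
  proof (induction n)
    case (Suc n)
    then show ?case using one[of "x + int n"] by (simp add: algebra_simps)
  qed simp
  from this[of "nat (y - x)"] show "x \<le> y \<Longrightarrow> ?thesis" by simp
qed

text \<open>An odd block of zeros behaves like a single zero, as pairs of zeros move freely.\<close>

lemma odd_zeros_change:
  assumes "pl \<or> y \<le> x"
  shows "(chain_step pl pr)\<^sup>*\<^sup>* (zeros (2 * k + 1) @ x # v) (zeros (2 * k + 1) @ y # v)"
proof -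
  \<comment> \<open>All zeros but the first are parked behind \<open>x\<close>, which then stands
    next to a single end zero; afterwards they return.\<close>
  have "(chain_step pl pr)\<^sup>*\<^sup>* ([0] @ (zeros (2 * k) @ [x]) @ v) ([0] @ (x # zeros (2 * k)) @ v)"
    using zeros_even_right mid_steps_chain by blast
  moreover have "(chain_step pl pr)\<^sup>*\<^sup>* (0 # x # zeros (2 * k) @ v) (0 # y # zeros (2 * k) @ v)"
    using assms left_zero_decrease left_zero_increase by (meson linear)
  moreover have "(chain_step pl pr)\<^sup>*\<^sup>* ([0] @ (y # zeros (2 * k)) @ v) ([0] @ (zeros (2 * k) @ [y]) @ v)"
    using zeros_even_left mid_steps_chain by blast
  ultimately show ?thesis by (simp add: zeros_Suc)
qed

lemma odd_zeros_change_right: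
  assumes "pr \<or> y \<le> x"
  shows "(chain_step pl pr)\<^sup>*\<^sup>* (v @ x # zeros (2 * k + 1)) (v @ y # zeros (2 * k + 1))"
  using chain_steps_rev[OF odd_zeros_change[of pr y x pl k "rev v"]] assms
  by (simp add: rev_zeros)

text \<open>The pair of zeros set free by the shift passes \<open>u\<close> and joins the front
  block. Outside that block two vertices disappear, which is the progress used in the inductions
  below.\<close>

lemma collapse:
  "mid_step\<^sup>*\<^sup>* (zeros l @ u @ [a, 0, b] @ v) (zeros (l + 2) @ u @ (a + b) # v)"
proof -
  have "mid_step\<^sup>*\<^sup>* ((zeros l @ u) @ [a, 0, b] @ v) ((zeros l @ u) @ [0, 0, a + b] @ v)"
    using shift[of a b a] by (intro mid_steps_append) (simp add: add.commute)
  moreover have "mid_step\<^sup>*\<^sup>* (zeros l @ (u @ zeros (2 * 1)) @ (a + b) # v) (zeros l @ (zeros (2 * 1) @ u) @ (a + b) # v)"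
    using zeros_even_left_list mid_steps_append by blast
  moreover have "zeros (2 * 1) = [0, 0]" by (simp add: zeros_def numeral_2_eq_2)
  ultimately show ?thesis unfolding zeros_add by (simp add: numeral_2_eq_2 zeros_Suc zeros_0)
qed

section \<open>Normal forms of linear chains\<close>

definition semistd :: "int list \<Rightarrow> bool" where
  "semistd ws \<longleftrightarrow> (\<exists>l r. (\<forall>w\<in>set r. w \<le> -2) \<and> (ws = zeros l @ r \<or> ws = zeros l @ r @ [0]))"

definition std :: "int list \<Rightarrow> bool" where
  "std ws \<longleftrightarrow> (\<exists>k r. (\<forall>w\<in>set r. w \<le> -2) \<and> ws = zeros (2 * k) @ r) \<or> (\<exists>k. ws = zeros (2 * k + 1))"

text \<open>The block \<open>zeros l\<close> absorbs, \<open>r\<close> is the finished part and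
  \<open>s\<close> the part still to be treated. The length of \<open>s\<close> is the main measure;
  the length of \<open>r\<close> breaks ties because contracting a -1 may hand the last entry of
  \<open>r\<close> back to \<open>s\<close>. Blocks of zeros are only used to lower weights, so
  arbitrary flags are allowed. The trailing 0 appears when nothing follows a zero with which it
  could be collapsed.\<close>

lemma normalize:
  assumes "l \<ge> 1" "\<forall>w\<in>set r. w \<le> -2"
  shows "\<exists>l' r'. l' \<ge> 1 \<and> (\<forall>w\<in>set r'. w \<le> -2) \<and>
    ((chain_step pl pr)\<^sup>*\<^sup>* (zeros l @ r @ s) (zeros l' @ r') \<or>
     (chain_step pl pr)\<^sup>*\<^sup>* (zeros l @ r @ s) (zeros l' @ r' @ [0]))"
  (is "?P l r s")
  using assms
proof (induction "(s, r)" arbitrary: s r l rule: wf_induct_rule[OF wf_measures[of "[length \<circ> fst, length \<circ> snd]"]])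
  case (1 s r l)
  let ?R = "(chain_step pl pr)\<^sup>*\<^sup>*"
  note l = \<open>l \<ge> 1\<close> and r = \<open>\<forall>w\<in>set r. w \<le> -2\<close>
  have IH: "?P l' r' s'" if "l' \<ge> 1" "\<forall>w\<in>set r'. w \<le> -2"
    "length s' < length s \<or> length s' = length s \<and> length r' < length r" for l' r' s'
    using 1(1)[of s' r' l'] that by auto
  have go: "?P l r s" if st: "?R (zeros l @ r @ s) (zeros l' @ r' @ s')"
    and le: "l' \<ge> 1" "\<forall>w\<in>set r'. w \<le> -2"
    "length s' < length s \<or> length s' = length s \<and> length r' < length r" for l' r' s'
  proof -
    obtain l'' r'' where i: "l'' \<ge> 1" "\<forall>w\<in>set r''. w \<le> -2"
      "?R (zeros l' @ r' @ s') (zeros l'' @ r'') \<or> ?R (zeros l' @ r' @ s') (zeros l'' @ r'' @ [0])"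
      using IH[OF le] by blast
    show ?thesis
      by (rule exI[of _ l''], rule exI[of _ r''])
        (use i rtranclp_trans[OF st, of "zeros l'' @ r''"] rtranclp_trans[OF st, of "zeros l'' @ r'' @ [0]"] in blast)
  qed
  have fin: "?P l r s" if "?R (zeros l @ r @ s) (zeros l' @ r' @ [0])" "l' \<ge> 1" "\<forall>w\<in>set r'. w \<le> -2" for l' r'
    using that by blast
  have m: "?R xs ys" if "mid_step\<^sup>*\<^sup>* xs ys" for xs ys
    using mid_steps_chain[OF that, of pl pr "[]" "[]"] by simp
  show ?case
  proof (cases s)
    case Nil
    then show ?thesis using l r by (metis append_Nil2 rtranclp.rtrancl_refl)
  next
    case (Cons b s')
    consider "b \<le> -2" | "b = -1" | "b = 0" | "b \<ge> 1" by linarith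
    then show ?thesis
    proof cases
      case 1
      show ?thesis by (rule go[of l "r @ [b]" s']) (use l r 1 Cons in auto)
    next
      case 2
      show ?thesis
      proof (cases r rule: rev_cases)
        case Nil
        show ?thesis
        proof (cases "odd l")
          \<comment> \<open>An odd block lowers the weight behind it to any smaller value, here from
            -1 to -2.\<close>
          case True
          then obtain k where k: "l = 2 * k + 1" using oddE by blast
          show ?thesis
            by (rule go[of l "[-2]" s']) (use odd_zeros_change[of pl "-2" "-1" pr k s'] l Cons k Nil 2 in auto)
        next
          case False
          then have "\<exists>k. l = 2 * k + 2" using l by presburger
          then obtain k where k: "l = 2 * k + 2" by blast
          \<comment> \<open>Behind an even block the -1 is contracted instead. This turns the last
            zero into 1 behind an odd block, which lowers the 1 back to 0, so \<open>l\<close> is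
            restored and one entry is gone.\<close>
          have z: "zeros l @ xs = zeros (2 * k + 1) @ 0 # xs" for xs using k by (simp add: zeros_snoc zeros_Suc)
          show ?thesis
          proof (cases s')
            case Nil': Nil
            have "?R (zeros l @ [-1]) (zeros (2 * k + 1) @ [1])"
              using chain_step.right_down[of pl pr "zeros (2 * k + 1)" 0] z by auto
            also have "?R (zeros (2 * k + 1) @ [1]) (zeros (2 * k + 1) @ [0])"
              by (rule odd_zeros_change) simp
            finally show ?thesis
              by (intro go[of l "[]" "[]"]) (use l Cons Nil Nil' 2 z[of "[]"] in auto)
          next
            case (Cons y s'')
            have "mid_step (zeros l @ [-1, y] @ s'') (zeros (2 * k + 1) @ [1, y + 1] @ s'')"
              using mid_step.down[of "zeros (2 * k + 1)" 0 y s''] z by auto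
            then have "?R (zeros l @ [-1, y] @ s'') (zeros (2 * k + 1) @ [1, y + 1] @ s'')"
              by (intro m) simp
            also have "?R (zeros (2 * k + 1) @ [1, y + 1] @ s'') (zeros (2 * k + 1) @ 0 # (y + 1) # s'')"
              using odd_zeros_change[of pl 0 1 pr k "(y + 1) # s''"] by simp
            finally show ?thesis
              by (intro go[of l "[]" "(y + 1) # s''"]) (use l \<open>s = b # s'\<close> Nil Cons 2 z in auto)
          qed
        qed
      next
        \<comment> \<open>The contraction raises \<open>x\<close>, possibly to -1, so
          \<open>x + 1\<close> has to be examined again and moves to \<open>s\<close>. The length of
          \<open>s\<close> stays the same and \<open>r\<close> gets shorter.\<close>
        case (snoc r' x)
        show ?thesis
        proof (cases s')
          case Nil
          have "?R (zeros l @ r @ s) (zeros l @ r' @ [x + 1])"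
            using chain_step.right_down[of pl pr "zeros l @ r'" x] Cons Nil snoc 2 by auto
          then show ?thesis by (rule go) (use l r Cons snoc Nil in auto)
        next
          case Cons': (Cons y s'')
          have "?R (zeros l @ r @ s) (zeros l @ r' @ ((x + 1) # (y + 1) # s''))"
            using mid_step.down[of "zeros l @ r'" x y s''] Cons Cons' snoc 2 by (intro m) auto
          then show ?thesis by (rule go) (use l r Cons snoc Cons' in auto)
        qed
      qed
    next
      case 3
      show ?thesis
      proof (cases r rule: rev_cases)
        case Nil
        then show ?thesis by (intro go[of "l + 1" "[]" s']) (use Cons 3 l in \<open>auto simp: zeros_snoc zeros_Suc\<close>)
      next
        case (snoc r' x)
        show ?thesis
        proof (cases s')
          case Nil
          then show ?thesis using fin[of l r] Cons 3 l r by simp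
        next
          case Cons': (Cons y s'')
          have "?R (zeros l @ r @ s) (zeros (l + 2) @ r' @ ((x + y) # s''))"
            using collapse[of l r' x y s''] Cons Cons' snoc 3 by (intro m) auto
          then show ?thesis by (rule go) (use l r Cons snoc Cons' in auto)
        qed
      qed
    next
      case 4
      show ?thesis
      proof (cases r rule: rev_cases)
        case Nil
        show ?thesis
        proof (cases "odd l")
          case True
          then obtain k where k: "l = 2 * k + 1" using oddE by blast
          show ?thesis
            by (rule go[of "l + 1" "[]" s'])
              (use odd_zeros_change[of pl 0 b pr k s'] Cons k Nil 4 in \<open>auto simp: zeros_snoc zeros_Suc\<close>)
        next
          case False
          then have "\<exists>k. l = 2 * k + 2" using l by presburger
          then obtain k where k: "l = 2 * k + 2" by blast
          show ?thesis
          proof (cases s')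
            case Nil': Nil
            \<comment> \<open>A positive last weight behind an even block: it is carried to the left
              end and blown up there against the first zero. This leaves a -1 next to the new end
              zero and a -1 next to the odd block on the right; both are lowered to -2. Finally an
              even number of zeros returns to the left and one zero stays at the right end.\<close>
            let ?t = "replicate (nat b - 1) (-2 :: int)"
            have "?R (zeros l @ [b]) (b # zeros l)"
              using zeros_even_right[of "k + 1" b] k by (intro m) simp
            also have "b # zeros l = [] @ [b, 0] @ zeros (2 * k + 1)" using k by (simp add: zeros_Suc)
            also have "?R \<dots> ([] @ ([0, -1] @ ?t @ [-1]) @ zeros (2 * k + 1))"
              using blow_right_zero[of b 0] 4 by (intro mid_steps_chain) simp
            also have "\<dots> = 0 # -1 # ?t @ [-1] @ zeros (2 * k + 1)" by simp
            also have "?R \<dots> (0 # -2 # ?t @ [-1] @ zeros (2 * k + 1))"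
              by (rule left_zero_decrease) simp
            also have "\<dots> = (0 # -2 # ?t) @ -1 # zeros (2 * k + 1)" by simp
            also have "?R \<dots> ((0 # -2 # ?t) @ -2 # zeros (2 * k + 1))"
              by (rule odd_zeros_change_right) simp
            also have "\<dots> = [0] @ ((-2 # ?t @ [-2]) @ zeros (2 * k)) @ [0]"
              using zeros_snoc[of "2 * k" "[]"] by (simp add: zeros_Suc)
            also have "?R \<dots> ([0] @ (zeros (2 * k) @ (-2 # ?t @ [-2])) @ [0])"
              by (intro mid_steps_chain zeros_even_left_list)
            also have "\<dots> = zeros (2 * k + 1) @ (-2 # ?t @ [-2]) @ [0]" by (simp add: zeros_Suc)
            finally show ?thesis by (intro fin[of "2 * k + 1" "-2 # ?t @ [-2]"]) (use Nil Nil' Cons in auto)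
          next
            case Cons': (Cons y s'')
            \<comment> \<open>Blowing up on the right of \<open>b\<close> makes \<open>b\<close>
              itself a zero of the front block, whose length becomes odd; it can then lower the
              adjacent -1.\<close>
            let ?t = "replicate (nat b - 1) (-2 :: int)"
            have "?R (zeros l @ [b, y] @ s'') (zeros l @ ([0, -1] @ ?t @ [y - 1]) @ s'')"
              using blow_right_zero[of b y] 4 by (intro mid_steps_chain) simp
            also have "\<dots> = zeros (2 * (k + 1) + 1) @ -1 # ?t @ (y - 1) # s''"
              using k by (simp add: zeros_snoc zeros_Suc)
            also have "?R \<dots> (zeros (2 * (k + 1) + 1) @ -2 # ?t @ (y - 1) # s'')"
              by (rule odd_zeros_change) simp
            also have "\<dots> = zeros (2 * (k + 1) + 1) @ (-2 # ?t) @ ((y - 1) # s'')" by simp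
            finally show ?thesis
              by (intro go[of "2 * (k + 1) + 1" "-2 # ?t" "(y - 1) # s''"]) (use Nil Cons' Cons in auto)
          qed
        qed
      next
        case (snoc r' x)
        \<comment> \<open>Blowing up on the left of \<open>b\<close> keeps the new weights in the
          finished part, except for the last -1 before the new zero. If the chain ends here, this
          end zero lowers the -1 to -2; otherwise \<open>collapse\<close> merges the -1 with the
          next weight.\<close>
        let ?t = "replicate (nat b - 1) (-2 :: int)"
        have *: "?R (zeros l @ r @ s) ((zeros l @ r') @ ((x - 1) # ?t @ [-1, 0]) @ s')"
          using mid_steps_chain[OF blow_left_zero[of b x], of pl pr "zeros l @ r'" s'] 4 snoc Cons by simp
        show ?thesis
        proof (cases s')
          case Nil
          note *
          also have "(zeros l @ r') @ ((x - 1) # ?t @ [-1, 0]) @ s' = (zeros l @ r' @ (x - 1) # ?t) @ -1 # zeros (2 * 0 + 1)"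
            using Nil by (simp add: zeros_def)
          also have "?R \<dots> ((zeros l @ r' @ (x - 1) # ?t) @ -2 # zeros (2 * 0 + 1))"
            by (rule odd_zeros_change_right) simp
          also have "\<dots> = zeros l @ (r' @ (x - 1) # ?t @ [-2]) @ [0]" by (simp add: zeros_def)
          finally show ?thesis by (rule fin) (use l r snoc in auto)
        next
          case Cons': (Cons y s'')
          note *
          also have "(zeros l @ r') @ ((x - 1) # ?t @ [-1, 0]) @ s' = zeros l @ (r' @ (x - 1) # ?t) @ [-1, 0, y] @ s''"
            using Cons' by simp
          also have "?R \<dots> (zeros (l + 2) @ (r' @ (x - 1) # ?t) @ ((-1 + y) # s''))"
            by (rule m[OF collapse])
          finally show ?thesis by (rule go) (use l r snoc Cons Cons' in auto)
        qed
      qed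
    qed
  qed
qed

text \<open>A positive weight needs an edge that can be blown up, either inside the chain or beyond
  one of its ends; the last assumption provides one. On the way to the semistandard form this is the
  only use of the flags.\<close>

lemma make_zero:
  assumes "b \<in> set ws" "b \<ge> 0" "length ws \<ge> 2 \<or> pl \<or> pr"
  shows "\<exists>u v. (chain_step pl pr)\<^sup>*\<^sup>* ws (u @ [0] @ v)"
proof -
  obtain u v where ws: "ws = u @ b # v" using assms(1) by (auto simp: in_set_conv_decomp)
  show ?thesis
  proof (cases "b = 0")
    case True
    then show ?thesis using ws by auto
  next
    case False
    then have b: "b \<ge> 1" using assms by simp
    have R: "\<exists>u v. (chain_step pl pr)\<^sup>*\<^sup>* (p @ [b, y] @ q) (u @ [0] @ v)" for p y q
      using mid_steps_chain[OF blow_right_zero[OF b, of y], of pl pr p q] by auto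
    have L: "\<exists>u v. (chain_step pl pr)\<^sup>*\<^sup>* (p @ [x, b] @ q) (u @ [0] @ v)" for p x q
      using mid_steps_chain[OF blow_left_zero[OF b, of x], of pl pr p q]
      by (metis append.assoc append_Cons append_Nil)
    show ?thesis
    proof (cases v)
      case (Cons y v')
      then show ?thesis using R[of u y v'] ws by simp
    next
      case v: Nil
      show ?thesis
      proof (cases u rule: rev_cases)
        case (snoc u' x)
        then show ?thesis using L[of u' x v] ws by simp
      next
        case Nil
        \<comment> \<open>The first blowup beyond the end creates the missing neighbour and already
          costs \<open>b\<close> one, so \<open>b - 1\<close> further blowups remain.\<close>
        then have w: "ws = [b]" using ws v by simp
        then consider pl | pr using assms by auto
        then show ?thesis
        proof cases
          case 1
          have s: "chain_step pl pr [b] [-1, b - 1]" using chain_step.left_up[of pl pr b "[]"] 1 by simp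
          show ?thesis
          proof (cases "b = 1")
            case True
            then show ?thesis using s w by (metis append_Cons append_Nil cancel_comm_monoid_add_class.diff_cancel r_into_rtranclp)
          next
            case False
            then have "b - 1 \<ge> 1" using b by simp
            from blow_left_zero[OF this, of "-1"]
            have "mid_step\<^sup>*\<^sup>* [-1, b - 1] ((- 1 - 1) # replicate (nat (b - 1) - 1) (- 2) @ [-1] @ [0] @ [])" by simp
            from mid_steps_chain[OF this, of pl pr "[]" "[]"] s w show ?thesis
              by (metis append_Cons append_Nil append_Nil2 append.assoc converse_rtranclp_into_rtranclp)
          qed
        next
          case 2
          have s: "chain_step pl pr [b] [b - 1, -1]" using chain_step.right_up[of pr pl "[]" b] 2 by simp
          show ?thesis
          proof (cases "b = 1")
            case True
            then show ?thesis using s w by (metis append_Cons append_Nil cancel_comm_monoid_add_class.diff_cancel r_into_rtranclp)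
          next
            case False
            then have "b - 1 \<ge> 1" using b by simp
            from blow_right_zero[OF this, of "-1"]
            have "mid_step\<^sup>*\<^sup>* [b - 1, -1] ([] @ [0] @ ([-1] @ replicate (nat (b - 1) - 1) (- 2) @ [- 1 - 1]))" by simp
            from mid_steps_chain[OF this, of pl pr "[]" "[]"] s w show ?thesis
              by (metis append_Cons append_Nil append_Nil2 append.assoc converse_rtranclp_into_rtranclp)
          qed
        qed
      qed
    qed
  qed
qed

text \<open>A zero at an end is such a block up to orientation; a zero with two neighbours yields a
  pair at the left end by \<open>collapse\<close> with an empty front block.\<close>

lemma zeros_left:
  assumes "b \<in> set ws" "b \<ge> 0" "length ws \<ge> 2 \<or> pl \<or> pr"
  shows "\<exists>l s. l \<ge> 1 \<and> ((chain_step pl pr)\<^sup>*\<^sup>* ws (zeros l @ s) \<or> (chain_step pr pl)\<^sup>*\<^sup>* (rev ws) (zeros l @ s))"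
proof -
  obtain u v where uv: "(chain_step pl pr)\<^sup>*\<^sup>* ws (u @ [0] @ v)" using make_zero[OF assms] by blast
  show ?thesis
  proof (cases u rule: rev_cases)
    case Nil
    then show ?thesis using uv by (intro exI[of _ 1] exI[of _ v]) (simp add: zeros_def)
  next
    case (snoc u' a)
    show ?thesis
    proof (cases v)
      case Nil
      then show ?thesis using chain_steps_rev[OF uv]
        by (intro exI[of _ 1] exI[of _ "rev u"]) (simp add: zeros_def)
    next
      case (Cons c v')
      have "(chain_step pl pr)\<^sup>*\<^sup>* (u @ [0] @ v) (zeros (0 + 2) @ u' @ (a + c) # v')"
        using mid_steps_chain[OF collapse[of 0 u' a c v'], of pl pr "[]" "[]"] snoc Cons
        by (simp add: zeros_0)
      with uv have "(chain_step pl pr)\<^sup>*\<^sup>* ws (zeros 2 @ (u' @ (a + c) # v'))"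
        by (simp add: numeral_2_eq_2)
      then show ?thesis by (meson one_le_numeral)
    qed
  qed
qed

lemma chain_semistd_aux:
  assumes "b \<in> set ws" "b \<ge> 0" "length ws \<ge> 2 \<or> pl \<or> pr"
  shows "\<exists>l r t p q. l \<ge> 1 \<and> (\<forall>w\<in>set r. w \<le> -2) \<and> (t = zeros l @ r \<or> t = zeros l @ r @ [0]) \<and>
    (p = pl \<and> q = pr \<and> (chain_step pl pr)\<^sup>*\<^sup>* ws t \<or> p = pr \<and> q = pl \<and> (chain_step pr pl)\<^sup>*\<^sup>* (rev ws) t)"
proof -
  obtain l s where l: "l \<ge> 1" and
    ls: "(chain_step pl pr)\<^sup>*\<^sup>* ws (zeros l @ s) \<or> (chain_step pr pl)\<^sup>*\<^sup>* (rev ws) (zeros l @ s)"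
    using zeros_left[OF assms] by blast
  from ls show ?thesis
  proof
    assume "(chain_step pl pr)\<^sup>*\<^sup>* ws (zeros l @ s)"
    then show ?thesis using normalize[OF l, of "[]" pl pr s]
      by (metis append_Nil empty_iff empty_set rtranclp_trans)
  next
    assume "(chain_step pr pl)\<^sup>*\<^sup>* (rev ws) (zeros l @ s)"
    then show ?thesis using normalize[OF l, of "[]" pr pl s]
      by (metis append_Nil empty_iff empty_set rtranclp_trans)
  qed
qed

lemma chain_semistd:
  assumes "b \<in> set ws" "b \<ge> 0" "length ws \<ge> 2 \<or> pl \<or> pr"
  shows "\<exists>t. (chain_step pl pr)\<^sup>*\<^sup>* ws t \<and> (semistd t \<or> semistd (rev t))"
proof -
  obtain l r t where "(\<forall>w\<in>set r. w \<le> -2)" "(t = zeros l @ r \<or> t = zeros l @ r @ [0])"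
    and t: "(chain_step pl pr)\<^sup>*\<^sup>* ws t \<or> (chain_step pr pl)\<^sup>*\<^sup>* (rev ws) t"
    using chain_semistd_aux[OF assms] by blast
  then have "semistd t" unfolding semistd_def by blast
  with t show ?thesis using chain_steps_rev[of pr pl "rev ws" t] by auto
qed

text \<open>With both flags set, zeros may also raise weights. An odd block raises the first entry
  of \<open>r\<close> to 0 and thereby becomes even; a trailing zero raises the last entry of
  \<open>r\<close> to 0, and the resulting pair moves to the front. Each repair costs one entry of
  \<open>r\<close>; if none is left, the chain consists of zeros only, which is standard.\<close>

lemma std_from_semistd:
  assumes "l \<ge> 1" "\<forall>w\<in>set r. w \<le> -2" "t = zeros l @ r \<or> t = zeros l @ r @ [0]"
  shows "\<exists>t'. (chain_step True True)\<^sup>*\<^sup>* t t' \<and> std t'"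
proof -
  let ?R = "(chain_step True True)\<^sup>*\<^sup>*"
  have 1: "\<exists>t'. ?R (zeros l @ r) t' \<and> std t'" if r: "\<forall>w\<in>set r. w \<le> -2" for l r
  proof (cases "even l")
    case True
    then show ?thesis using r unfolding std_def by (metis dvd_def rtranclp.rtrancl_refl)
  next
    case False
    then obtain k where k: "l = 2 * k + 1" using oddE by blast
    show ?thesis
    proof (cases r)
      case Nil
      then show ?thesis using k unfolding std_def by auto
    next
      case (Cons x r')
      have "?R (zeros l @ r) (zeros (2 * k + 1) @ 0 # r')"
        using odd_zeros_change[of True 0 x True k r'] k Cons by simp
      moreover have "zeros (2 * k + 1) @ 0 # r' = zeros (2 * (k + 1)) @ r'"
        by (simp add: zeros_snoc zeros_Suc)
      moreover have "std (zeros (2 * (k + 1)) @ r')" using r Cons unfolding std_def by fastforce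
      ultimately show ?thesis by metis
    qed
  qed
  show ?thesis
  proof (cases "t = zeros l @ r")
    case True
    then show ?thesis using 1 assms by blast
  next
    case False
    then have t: "t = zeros l @ r @ [0]" using assms by blast
    show ?thesis
    proof (cases r rule: rev_cases)
      case Nil
      then have "t = zeros (l + 1) @ []" using t by (simp add: zeros_snoc zeros_Suc)
      then show ?thesis using 1[of "[]"] by fastforce
    next
      case (snoc r' x)
      have "?R t (zeros l @ r' @ [0, 0])"
        using odd_zeros_change_right[of True 0 x True "zeros l @ r'" 0] t snoc by (simp add: zeros_def)
      also have "?R (zeros l @ r' @ [0, 0]) (zeros l @ (zeros (2 * 1) @ r') @ [])"
        using mid_steps_chain[OF zeros_even_left_list[of r' 1], of True True "zeros l" "[]"]
        by (simp add: zeros_def numeral_2_eq_2)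
      finally have "?R t (zeros (l + 2) @ r')" unfolding zeros_add by simp
      then show ?thesis using 1[of r' "l + 2"] assms(2) snoc by (metis in_set_conv_decomp rtranclp_trans Un_iff set_append)
    qed
  qed
qed

lemma chain_std:
  assumes "b \<in> set ws" "b \<ge> 0"
  shows "\<exists>t. (chain_step True True)\<^sup>*\<^sup>* ws t \<and> (std t \<or> std (rev t))"
proof -
  obtain l r t where lr: "l \<ge> 1" "(\<forall>w\<in>set r. w \<le> -2)" "(t = zeros l @ r \<or> t = zeros l @ r @ [0])"
    and t: "(chain_step True True)\<^sup>*\<^sup>* ws t \<or> (chain_step True True)\<^sup>*\<^sup>* (rev ws) t"
    using chain_semistd_aux[OF assms, of True True] by blast
  obtain t' where t': "(chain_step True True)\<^sup>*\<^sup>* t t'" "std t'" using std_from_semistd[OF lr] by blast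
  from t show ?thesis
  proof
    assume "(chain_step True True)\<^sup>*\<^sup>* ws t"
    then show ?thesis using t' by (meson rtranclp_trans)
  next
    assume "(chain_step True True)\<^sup>*\<^sup>* (rev ws) t"
    then have "(chain_step True True)\<^sup>*\<^sup>* (rev ws) t'" using t' by simp
    from chain_steps_rev[OF this] show ?thesis using t'(2) by (metis rev_rev_ident)
  qed
qed

section \<open>Rewriting circular lists of weights\<close>

definition circle_std :: "int list \<Rightarrow> bool" where
  "circle_std ws \<longleftrightarrow>
     (\<exists>k r. r \<noteq> [] \<and> (\<forall>w\<in>set r. w \<le> -2) \<and> ws = zeros (2 * k) @ r) \<or>
     (\<exists>l w. w \<le> 0 \<and> ws = zeros l @ [w]) \<or> (\<exists>k. ws = zeros (2 * k) @ [-1, -1])"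

lemma circle_rotate: "circle_step\<^sup>*\<^sup>* (xs @ ys) (ys @ xs)"
proof (induction xs arbitrary: ys)
  case (Cons x xs)
  have "circle_step\<^sup>*\<^sup>* (x # xs @ ys) (xs @ ys @ [x])"
    using circle_step.rot[of x "xs @ ys"] by auto
  also have "circle_step\<^sup>*\<^sup>* (xs @ ys @ [x]) ((ys @ [x]) @ xs)" by (rule Cons)
  finally show ?case by simp
qed simp

text \<open>An even block passes every list, so the other entries rotate as if it were absent. Hence
  circles can be normalized behind a fixed block of even length.\<close>

lemma circle_zeros_rotate: "circle_step\<^sup>*\<^sup>* (zeros (2 * k) @ xs @ ys) (zeros (2 * k) @ ys @ xs)"
proof -
  have "circle_step\<^sup>*\<^sup>* (zeros (2 * k) @ (xs @ ys)) ((xs @ ys) @ zeros (2 * k))" by (rule circle_rotate)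
  also have "\<dots> = xs @ (ys @ zeros (2 * k)) @ []" by simp
  also have "circle_step\<^sup>*\<^sup>* \<dots> (xs @ (zeros (2 * k) @ ys) @ [])"
    by (intro mid_steps_circle zeros_even_left_list)
  also have "\<dots> = xs @ (zeros (2 * k) @ ys)" by simp
  also have "circle_step\<^sup>*\<^sup>* \<dots> ((zeros (2 * k) @ ys) @ xs)" by (rule circle_rotate)
  finally show ?thesis by simp
qed

lemma circle_mid: "mid_step\<^sup>*\<^sup>* xs ys \<Longrightarrow> circle_step\<^sup>*\<^sup>* xs ys"
  using mid_steps_circle[of xs ys "[]" "[]"] by simp

lemma circle_mid1: "mid_step xs ys \<Longrightarrow> circle_step\<^sup>*\<^sup>* xs ys"
  by (auto intro: circle_mid)

lemma circle_collapse:
  "circle_step\<^sup>*\<^sup>* (zeros (2 * k) @ u @ [a, 0, b] @ v) (zeros (2 * (k + 1)) @ u @ (a + b) # v)"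
  using circle_mid[OF collapse[of "2 * k" u a b v]] by simp

text \<open>The analogues of the loop blowup and blowdown in the presence of pairs of zeros.\<close>

lemma circle_single_up: "circle_step\<^sup>*\<^sup>* (zeros (2 * k) @ [b]) (zeros (2 * k) @ [b - 2, -1])"
proof (cases k)
  case 0
  then show ?thesis using circle_step.loop_up[of b] by (auto simp: zeros_0)
next
  case (Suc j)
  have z: "zeros (2 * k) @ xs = zeros (2 * j) @ [0, 0] @ xs" for xs
    using Suc by (simp add: zeros_snoc zeros_Suc)
  have "circle_step\<^sup>*\<^sup>* (zeros (2 * j) @ [0, 0, b] @ []) (zeros (2 * j) @ [1, 0, b - 1] @ [])"
    using shift[of 0 b "-1"] by (intro mid_steps_circle) simp
  also have "\<dots> = zeros (2 * j) @ [1, 0] @ [b - 1]" by simp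
  also have "circle_step\<^sup>*\<^sup>* \<dots> (zeros (2 * j) @ [b - 1] @ [1, 0])" by (rule circle_zeros_rotate)
  also have "circle_step\<^sup>*\<^sup>* \<dots> (([b - 1] @ [1, 0]) @ zeros (2 * j))" by (rule circle_rotate)
  also have "\<dots> = [] @ [b - 1, 1] @ 0 # zeros (2 * j)" by simp
  also have "circle_step\<^sup>*\<^sup>* \<dots> ([] @ [b - 1 - 1, -1, 1 - 1] @ 0 # zeros (2 * j))"
    by (intro circle_mid1 mid_step.up)
  also have "\<dots> = [b - 2, -1] @ zeros (2 * k)" using Suc by (simp add: zeros_Suc)
  also have "circle_step\<^sup>*\<^sup>* \<dots> (zeros (2 * k) @ [b - 2, -1])" by (rule circle_rotate)
  finally show ?thesis using z by simp
qed

lemma circle_single_down: "circle_step\<^sup>*\<^sup>* (zeros (2 * k) @ [y, -1]) (zeros (2 * k) @ [y + 2])"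
proof (cases k)
  case 0
  then show ?thesis using circle_step.loop_down[of y] by (auto simp: zeros_0)
next
  case (Suc j)
  have z: "zeros (2 * k) @ xs = zeros (2 * j) @ [0, 0] @ xs" for xs
    using Suc by (simp add: zeros_snoc zeros_Suc)
  have "circle_step\<^sup>*\<^sup>* (zeros (2 * k) @ [y, -1]) ([y, -1] @ zeros (2 * k))" by (rule circle_rotate)
  also have "\<dots> = [] @ [y, -1, 0] @ (0 # zeros (2 * j))" using Suc by (simp add: zeros_Suc)
  \<comment> \<open>The reverse route: the contraction gives the unit meant for \<open>y\<close> to
    a zero, and the final shift returns it.\<close>
  also have "circle_step\<^sup>*\<^sup>* \<dots> ([] @ [y + 1, 0 + 1] @ (0 # zeros (2 * j)))"
    by (intro circle_mid1 mid_step.down)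
  also have "\<dots> = ([y + 1] @ [1, 0]) @ zeros (2 * j)" by simp
  also have "circle_step\<^sup>*\<^sup>* \<dots> (zeros (2 * j) @ ([y + 1] @ [1, 0]))" by (rule circle_rotate)
  also have "circle_step\<^sup>*\<^sup>* \<dots> (zeros (2 * j) @ [1, 0] @ [y + 1])" by (rule circle_zeros_rotate)
  also have "\<dots> = zeros (2 * j) @ [1, 0, y + 1] @ []" by simp
  also have "circle_step\<^sup>*\<^sup>* \<dots> (zeros (2 * j) @ [0, 0, y + 2] @ [])"
    using shift[of 1 "y + 1" 1] by (intro mid_steps_circle) (simp add: add.commute)
  finally show ?thesis using z by simp
qed

text \<open>Going round the circle the other way, the zero made out of \<open>b\<close> meets
  \<open>y\<close> again. Thus \<open>y\<close> first pays one for the blowups and then absorbs the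
  last -1, which accounts for \<open>y - 2\<close>.\<close>

lemma circle_positive_two:
  assumes "b \<ge> 1"
  shows "circle_step\<^sup>*\<^sup>* (zeros (2 * k) @ [y, b]) (zeros (2 * (k + 1)) @ (y - 2) # replicate (nat b - 1) (-2))"
proof -
  let ?t = "replicate (nat b - 1) (-2 :: int)"
  have "circle_step\<^sup>*\<^sup>* (zeros (2 * k) @ [y, b] @ []) (zeros (2 * k) @ ((y - 1) # ?t @ [-1, 0]) @ [])"
    using assms by (intro mid_steps_circle blow_left_zero)
  also have "\<dots> = zeros (2 * k) @ ((y - 1) # ?t) @ [-1, 0]" by simp
  also have "circle_step\<^sup>*\<^sup>* \<dots> (zeros (2 * k) @ [-1, 0] @ ((y - 1) # ?t))" by (rule circle_zeros_rotate)
  also have "\<dots> = zeros (2 * k) @ [] @ [-1, 0, y - 1] @ ?t" by simp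
  also have "circle_step\<^sup>*\<^sup>* \<dots> (zeros (2 * (k + 1)) @ [] @ (-1 + (y - 1)) # ?t)" by (rule circle_collapse)
  finally show ?thesis by simp
qed

text \<open>The neighbours of \<open>b\<close> only get smaller and all inserted entries are -2, so
  the number of nonnegative entries outside the block drops although the list may get
  longer.\<close>

lemma circle_positive:
  assumes "b \<ge> 1"
  shows "circle_step\<^sup>*\<^sup>* (zeros (2 * k) @ [x, b, y] @ m)
    (zeros (2 * (k + 1)) @ (x - 1) # replicate (nat b - 1) (-2) @ (y - 1) # m)"
proof -
  let ?t = "replicate (nat b - 1) (-2 :: int)"
  have "circle_step\<^sup>*\<^sup>* (zeros (2 * k) @ [x, b] @ (y # m)) (zeros (2 * k) @ ((x - 1) # ?t @ [-1, 0]) @ (y # m))"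
    using assms by (intro mid_steps_circle blow_left_zero)
  also have "\<dots> = zeros (2 * k) @ ((x - 1) # ?t) @ [-1, 0, y] @ m" by simp
  also have "circle_step\<^sup>*\<^sup>* \<dots> (zeros (2 * (k + 1)) @ ((x - 1) # ?t) @ (-1 + y) # m)" by (rule circle_collapse)
  finally show ?thesis by simp
qed

text \<open>The number of nonnegative entries has to come first in the measure, since absorbing a
  weight \<open>b\<close> inserts \<open>b - 1\<close> new entries. The length takes over when only
  negative entries are left and -1 is contracted. Lists with at most two entries are treated
  separately, because there the two neighbours of a vertex are not distinct entries.\<close>

lemma circle_normalize:
  assumes "t \<noteq> []"
  shows "\<exists>z. circle_step\<^sup>*\<^sup>* (zeros (2 * k) @ t) z \<and> circle_std z"
  using assms
proof (induction t arbitrary: k rule: wf_induct_rule[OF wf_measures[of "[\<lambda>t. length (filter (\<lambda>w. w \<ge> 0) t), length]"]])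
  case (1 t k)
  let ?R = "circle_step\<^sup>*\<^sup>*"
  let ?P = "\<lambda>t :: int list. length (filter (\<lambda>w. w \<ge> 0) t)"
  have go: "\<exists>z. ?R s z \<and> circle_std z" if R: "?R s (zeros (2 * k') @ t')" and sm: "t' \<noteq> []"
    "?P t' < ?P t \<or> ?P t' = ?P t \<and> length t' < length t" for s k' t'
  proof -
    obtain z where "?R (zeros (2 * k') @ t') z" "circle_std z"
      using 1(1)[of t' k'] sm by auto
    then show ?thesis using rtranclp_trans[OF R] by blast
  qed
  have std1: "circle_std (zeros (2 * k) @ r)" if "r \<noteq> []" "\<forall>w\<in>set r. w \<le> -2" for k r
    using that unfolding circle_std_def by blast
  have std2: "circle_std (zeros l @ [w])" if "w \<le> 0" for l w
    using that unfolding circle_std_def by blast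
  have std2': "circle_std (zeros l @ [0, w])" if "w \<le> 0" for l w
    using std2[OF that, of "Suc l"] by (simp add: zeros_snoc zeros_Suc)
  have std3: "circle_std (zeros (2 * k) @ [-1, -1])" for k
    unfolding circle_std_def by blast
  have triv: "?R s z \<Longrightarrow> circle_std z \<Longrightarrow> \<exists>z. ?R s z \<and> circle_std z" for s z by blast
  have rot: "\<exists>z. ?R (zeros (2 * k) @ p @ q) z \<and> circle_std z"
    if "\<exists>z. ?R (zeros (2 * k) @ q @ p) z \<and> circle_std z" for p q k
    using that circle_zeros_rotate[of k p q] by (meson rtranclp_trans)
  show ?case
  proof (cases "\<exists>b\<in>set t. b \<ge> 0")
    case True
    then obtain b p q where b: "b \<ge> 0" and t: "t = p @ b # q" by (metis in_set_conv_decomp)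
    define t' where "t' = q @ p"
    have P: "?P t = Suc (?P t')" and len: "length t = Suc (length t')"
      using b t by (auto simp: t'_def)
    have "\<exists>z. ?R (zeros (2 * k) @ (b # t')) z \<and> circle_std z"
    proof (cases "b = 0")
      case b0: True
      consider "t' = []" | y where "t' = [y]" | c m d where "t' = c # m @ [d]"
        by (metis append_Nil append_Cons list.exhaust rev_exhaust)
      then show ?thesis
      proof cases
        case 1
        then show ?thesis using b0 std2[of 0] triv by auto
      next
        case (2 y)
        show ?thesis
        proof (cases "y \<le> 0")
          case True
          then show ?thesis using b0 2 std2' triv by auto
        next
          case False
          then have y: "y \<ge> 1" by simp
          have "circle_std (zeros (2 * (k + 1)) @ (0 - 2) # replicate (nat y - 1) (-2))" by (rule std1) auto
          then show ?thesis using circle_positive_two[OF y, of k 0] 2 b0 by auto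
        qed
      next
        \<comment> \<open>The sum \<open>d + c\<close> is nonnegative only if \<open>d\<close> or
          \<open>c\<close> is, so the loss of the 0 lowers the count.\<close>
        case (3 c m d)
        have "\<exists>z. ?R (zeros (2 * k) @ ([d] @ (0 # c # m))) z \<and> circle_std z"
          by (rule go[of _ "k + 1" "(d + c) # m"]) (use circle_collapse[of k "[]" d c m] P 3 in auto)
        then show ?thesis using rot[where k = k and p = "[d]" and q = "0 # c # m"] rot[where k = k and p = "0 # c # m" and q = "[d]"] 3 b0 by auto
      qed
    next
      case False
      then have b1: "b \<ge> 1" using b by simp
      consider "t' = []" | y where "t' = [y]" | c m d where "t' = c # m @ [d]"
        by (metis append_Nil append_Cons list.exhaust rev_exhaust)
      then show ?thesis
      proof cases
        case 1
        \<comment> \<open>The loop blowup splits \<open>b\<close> into \<open>b - 2\<close> and -1.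
          For \<open>b = 1\<close> this is the exceptional form with two entries -1, for
          \<open>b = 2\<close> a further zero followed by -1; from 3 on, the positive weight
          \<open>b - 2\<close> is absorbed by its neighbour -1.\<close>
        consider "b = 1" | "b = 2" | "b \<ge> 3" using b1 by linarith
        then show ?thesis
        proof cases
          case b: 1
          then show ?thesis using circle_single_up[of k b] std3[of k] \<open>t' = []\<close> by auto
        next
          case b: 2
          then show ?thesis using circle_single_up[of k b] std2'[of "-1" "2 * k"] \<open>t' = []\<close> by auto
        next
          case b: 3
          have "?R (zeros (2 * k) @ [b]) (zeros (2 * k) @ [b - 2] @ [-1])"
            using circle_single_up[of k b] by simp
          also have "?R (zeros (2 * k) @ [b - 2] @ [-1]) (zeros (2 * k) @ [-1] @ [b - 2])"
            by (rule circle_zeros_rotate)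
          also have "?R \<dots> (zeros (2 * (k + 1)) @ (-1 - 2) # replicate (nat (b - 2) - 1) (-2))"
            using circle_positive_two[of "b - 2" k "-1"] b by simp
          finally have "?R (zeros (2 * k) @ [b]) (zeros (2 * (k + 1)) @ (-1 - 2) # replicate (nat (b - 2) - 1) (-2))" .
          moreover have "circle_std (zeros (2 * (k + 1)) @ (-1 - 2) # replicate (nat (b - 2) - 1) (-2))"
            by (rule std1) auto
          ultimately show ?thesis using \<open>t' = []\<close> by auto
        qed
      next
        case (2 y)
        have "\<exists>z. ?R (zeros (2 * k) @ [y, b]) z \<and> circle_std z"
          by (rule go[OF circle_positive_two[OF b1, of k y]]) (use P 2 in auto)
        then show ?thesis using rot[where k = k and p = "[b]" and q = "[y]"] 2 by auto
      next
        case (3 c m d)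
        have "\<exists>z. ?R (zeros (2 * k) @ ([d, b, c] @ m)) z \<and> circle_std z"
          by (rule go[OF circle_positive[OF b1, of k d c m]]) (use P 3 in auto)
        then show ?thesis using rot[where k = k and p = "b # c # m" and q = "[d]"] 3 by auto
      qed
    qed
    then show ?thesis using rot[where k = k and p = p and q = "b # q"] by (simp add: t t'_def)
  next
    case False
    then have neg: "\<forall>w\<in>set t. w \<le> -1" by fastforce
    show ?thesis
    proof (cases "-1 \<in> set t")
      case no: False
      then have "\<forall>w\<in>set t. w \<le> -2" using neg
        by (smt (verit))
      then show ?thesis using std1[of t k] 1(2) by blast
    next
      case True
      then obtain p q where t: "t = p @ -1 # q" by (metis in_set_conv_decomp)
      define t' where "t' = q @ p"
      have neg': "\<forall>w\<in>set t'. w \<le> -1" using neg t by (auto simp: t'_def)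
      have P0: "?P s = 0" if "\<forall>w\<in>set s. w \<le> -1" for s
        using that by (auto simp: filter_empty_conv)
      have P: "?P t = 0" using P0 neg by blast
      have len: "length t = Suc (length t')" using t by (auto simp: t'_def)
      have go': "\<exists>z. ?R s z \<and> circle_std z" if "?R s (zeros (2 * k') @ s')" "s' \<noteq> []"
        "\<forall>w\<in>set s'. w \<le> -1" "length s' < length t" for s k' s'
        using go[OF that(1,2)] P0[OF that(3)] P that(4) by simp
      have "\<exists>z. ?R (zeros (2 * k) @ (-1 # t')) z \<and> circle_std z"
      proof -
        consider "t' = []" | y where "t' = [y]" | y m x where "t' = y # m @ [x]"
          by (metis append_Nil append_Cons list.exhaust rev_exhaust)
        then show ?thesis
        proof cases
          case 1
          then show ?thesis using std2[of "-1"] triv by auto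
        next
          case (2 y)
          show ?thesis
          proof (cases "y = -1")
            case True
            then show ?thesis using 2 std3 triv by auto
          next
            case False
            then have "y + 2 \<le> 0" using neg' 2 by simp
            then have "circle_std (zeros (2 * k) @ [y + 2])" by (rule std2)
            then have "\<exists>z. ?R (zeros (2 * k) @ ([y] @ [-1])) z \<and> circle_std z"
              using circle_single_down[of k y] by auto
            then show ?thesis using rot[where k = k and p = "[-1]" and q = "[y]"] 2 by auto
          qed
        next
          case (3 y m x)
          have xy: "x \<le> -1" "y \<le> -1" "\<forall>w\<in>set m. w \<le> -1" using neg' 3 by auto
          have R: "?R (zeros (2 * k) @ ([x] @ (-1 # y # m))) (zeros (2 * k) @ [x + 1, y + 1] @ m)"
            using mid_step.down[of "zeros (2 * k)" x y m] by (intro circle_mid1) simp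
          have "\<exists>z. ?R (zeros (2 * k) @ [x + 1, y + 1] @ m) z \<and> circle_std z"
          proof -
            \<comment> \<open>A neighbour equal to -1 becomes 0 and is collapsed at once. One of the
              merged weights is then at most 0 and the other at most -1, so all entries remain
              negative and the length decides. Without a further entry the list is already
              standard.\<close>
            consider "x \<le> -2" "y \<le> -2" | "x = -1" | "y = -1" "x \<le> -1" using xy by linarith
            then show ?thesis
            proof cases
              case 1
              then show ?thesis using xy 3 len by (intro go'[of _ k "[x + 1, y + 1] @ m"]) auto
            next
              case 2
              show ?thesis
              proof (cases m rule: rev_cases)
                case Nil
                then show ?thesis using std2'[of "y + 1" "2 * k"] 2 xy triv by auto
              next
                case (snoc m' d)
                have "\<exists>z. ?R (zeros (2 * k) @ ([d] @ (0 # (y + 1) # m'))) z \<and> circle_std z"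
                  by (rule go'[of _ "k + 1" "(d + (y + 1)) # m'"])
                    (use circle_collapse[of k "[]" d "y + 1" m'] 3 xy snoc len in auto)
                then show ?thesis using rot[where k = k and p = "0 # (y + 1) # m'" and q = "[d]"] 2 snoc by auto
              qed
            next
              case y: 3
              show ?thesis
              proof (cases m)
                case Nil
                have "\<exists>z. ?R (zeros (2 * k) @ ([0] @ [x + 1])) z \<and> circle_std z"
                  using std2'[of "x + 1" "2 * k"] y triv by auto
                then show ?thesis using rot[where k = k and p = "[x + 1]" and q = "[0]"] y Nil by auto
              next
                case (Cons c m')
                show ?thesis
                  by (rule go'[of _ "k + 1" "(x + 1 + c) # m'"])
                    (use circle_collapse[of k "[]" "x + 1" c m'] 3 y xy Cons len in auto)
              qed
            qed
          qed
          then have "\<exists>z. ?R (zeros (2 * k) @ ([x] @ (-1 # y # m))) z \<and> circle_std z"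
            using R by (meson rtranclp_trans)
          then show ?thesis using rot[where k = k and p = "-1 # y # m" and q = "[x]"] 3 by auto
        qed
      qed
      then show ?thesis using rot[where k = k and p = p and q = "-1 # q"] by (simp add: t t'_def)
    qed
  qed
qed

lemma circle_steps_std: "t \<noteq> [] \<Longrightarrow> \<exists>z. circle_step\<^sup>*\<^sup>* t z \<and> circle_std z"
  using circle_normalize[of t 0] by (simp add: zeros_0)

section \<open>Blowups and blowdowns along paths\<close>

text \<open>A recursive form of the edge multisets in \<open>is_chain\<close> and
  \<open>is_circle\<close> that can be split at any vertex. A circle becomes a path returning to its
  first vertex.\<close>

fun path_edges :: "'v list \<Rightarrow> 'v set multiset" where
  "path_edges (x # y # zs) = add_mset {x, y} (path_edges (y # zs))"
| "path_edges [] = {#}"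
| "path_edges [x] = {#}"

lemma mset_path: "mset (map2 (\<lambda>a b. {a, b}) xs (tl xs)) = path_edges xs"
  by (induction xs rule: path_edges.induct) auto

lemma path_edges_append: "path_edges (xs @ a # ys) = path_edges (xs @ [a]) + path_edges (a # ys)"
  by (induction xs rule: path_edges.induct) auto

lemma path_edges_snoc: "xs \<noteq> [] \<Longrightarrow> path_edges (xs @ [y]) = add_mset {last xs, y} (path_edges xs)"
  by (induction xs rule: path_edges.induct) auto

lemma path_edges_Cons: "xs \<noteq> [] \<Longrightarrow> path_edges (x # xs) = add_mset {x, hd xs} (path_edges xs)"
  by (cases xs) auto

lemma path_edges_rev: "path_edges (rev xs) = path_edges xs"
proof (induction xs rule: path_edges.induct)
  case (1 x y zs)
  then show ?case using path_edges_append[of "rev zs" y "[x]"] by (simp add: insert_commute)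
qed auto

lemma path_edges_mid:
  "path_edges (p @ [a, b] @ q) = add_mset {a, b} (path_edges (p @ [a]) + path_edges (b # q))"
  using path_edges_append[of p a "b # q"] by simp

lemma path_edges_mid3:
  "path_edges (p @ [a, v, b] @ q) = add_mset {a, v} (add_mset {v, b} (path_edges (p @ [a]) + path_edges (b # q)))"
  using path_edges_append[of p a "v # b # q"] by simp

lemma path_edges_subset: "e \<in># path_edges xs \<Longrightarrow> e \<subseteq> set xs"
  by (induction xs rule: path_edges.induct) auto

lemma mset_circle: "mset (map2 (\<lambda>a b. {a, b}) (x # xs) (rotate1 (x # xs))) = path_edges (x # xs @ [x])"
proof -
  have "mset (map2 (\<lambda>a b. {a, b}) (y # xs) (xs @ [z])) = path_edges (y # xs @ [z])" for y z
    by (induction xs arbitrary: y) auto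
  then show ?thesis by simp
qed

text \<open>Degrees relative to a multiset of edges, so that they add up over a decomposition of the
  edges of a graph.\<close>

definition mdeg :: "'v set multiset \<Rightarrow> 'v \<Rightarrow> nat" where
  "mdeg E u = size {#e \<in># E. u \<in> e#} + size {#e \<in># E. e = {u}#}"

lemma deg_mdeg: "deg G = mdeg (edges G)"
  by (simp add: fun_eq_iff deg_def mdeg_def)

lemma mdeg_empty [simp]: "mdeg {#} u = 0"
  by (simp add: mdeg_def)

lemma mdeg_add [simp]: "mdeg (add_mset {a, b} E) u = of_bool (u = a) + of_bool (u = b) + mdeg E u"
  by (auto simp: mdeg_def)

lemma mdeg_loop [simp]: "mdeg (add_mset {a} E) u = 2 * of_bool (u = a) + mdeg E u"
  using mdeg_add[of a a E u] by simp

lemma mdeg_union [simp]: "mdeg (E + F) u = mdeg E u + mdeg F u"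
  by (simp add: mdeg_def)

lemma mdeg_zero_iff: "mdeg E u = 0 \<longleftrightarrow> (\<forall>e. e \<in># E \<longrightarrow> u \<notin> e)"
  by (auto simp: mdeg_def)

lemma mdeg_path:
  "distinct xs \<Longrightarrow> u \<in> set xs \<Longrightarrow> mdeg (path_edges xs) u = of_bool (u \<noteq> hd xs) + of_bool (u \<noteq> last xs)"
proof (induction xs rule: path_edges.induct)
  case (1 x y zs)
  show ?case
  proof (cases "u = x")
    case True
    then have "mdeg (path_edges (y # zs)) u = 0"
      using 1(2) path_edges_subset[of _ "y # zs"] by (force simp: mdeg_zero_iff)
    then show ?thesis using True 1(2) by (auto dest: last_in_set split: if_splits)
  next
    case False
    then show ?thesis using 1 by auto
  qed
qed auto

section \<open>Single blowups and blowdowns of graphs\<close>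

lemma adjacent_sym: "adjacent G u v \<Longrightarrow> adjacent G v u"
  by (simp add: adjacent_def insert_commute)

lemma adjacent_rtranclp_sym: "(adjacent G)\<^sup>*\<^sup>* u v \<Longrightarrow> (adjacent G)\<^sup>*\<^sup>* v u"
  by (induction rule: rtranclp_induct) (auto intro: adjacent_sym converse_rtranclp_into_rtranclp)

lemma rtranclp_image:
  assumes "\<And>x y. R x y \<Longrightarrow> S\<^sup>*\<^sup>* (f x) (f y)" and "R\<^sup>*\<^sup>* x y"
  shows "S\<^sup>*\<^sup>* (f x) (f y)"
  using assms(2) by (induction rule: rtranclp_induct) (auto intro: assms(1) rtranclp_trans)

lemma weighted_graphD:
  assumes "weighted_graph G"
  shows "finite (verts G)" "verts G \<noteq> {}" "e \<in># edges G \<Longrightarrow> e \<subseteq> verts G" "e \<in># edges G \<Longrightarrow> e \<noteq> {}"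
    "u \<in> verts G \<Longrightarrow> v \<in> verts G \<Longrightarrow> (adjacent G)\<^sup>*\<^sup>* u v"
  using assms unfolding weighted_graph_def connected_graph_def by auto

lemma branching_points_eq:
  assumes "v \<notin> verts G" "verts G' = insert v (verts G)" "deg G' v \<le> 2"
    "\<And>u. u \<in> verts G \<Longrightarrow> deg G' u = deg G u \<or> deg G u \<le> 2 \<and> deg G' u \<le> 2"
  shows "branching_points G' = branching_points G" "total_branching G' = total_branching G"
proof -
  show *: "branching_points G' = branching_points G"
    using assms unfolding branching_points_def by fastforce
  show "total_branching G' = total_branching G"
    unfolding total_branching_def * using assms(4)
    by (intro sum.cong) (fastforce simp: branching_points_def)+
qed

lemma all_add_mset: "(\<forall>e. e \<in># add_mset x F \<longrightarrow> P e) \<longleftrightarrow> P x \<and> (\<forall>e. e \<in># F \<longrightarrow> P e)"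
  by auto

text \<open>Subdividing an edge creates a vertex of degree 2 and keeps all other degrees. The first
  claim is an equivalence because a blowdown is defined as an inverse blowup: for it,
  \<open>G\<close> has to be recognized as a weighted graph starting from \<open>G'\<close>.\<close>

lemma inner_shape:
  assumes v: "v \<notin> verts G" and eG: "edges G = add_mset {a, b} E" and vG': "verts G' = insert v (verts G)"
    and eG': "edges G' = add_mset {a, v} (add_mset {v, b} E)" and E: "\<And>e. e \<in># E \<Longrightarrow> v \<notin> e"
    and a: "a \<noteq> v" and b: "b \<noteq> v"
  shows "weighted_graph G' \<longleftrightarrow> weighted_graph G"
    "branching_points G' = branching_points G" "total_branching G' = total_branching G"
proof -
  have d: "deg G' u = deg G u" if "u \<in> verts G" for u
    using that v by (auto simp: deg_mdeg eG eG')
  have "mdeg E v = 0" using E by (auto simp: mdeg_zero_iff)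
  then have dv: "deg G' v = 2" using a b by (auto simp: deg_mdeg eG')
  show "branching_points G' = branching_points G" "total_branching G' = total_branching G"
    using branching_points_eq[OF v vG'] d dv by auto
  have basic: "(finite (verts G') \<and> verts G' \<noteq> {} \<and> (\<forall>e. e \<in># edges G' \<longrightarrow> e \<subseteq> verts G' \<and> card e \<in> {1, 2}))
    \<longleftrightarrow> (finite (verts G) \<and> verts G \<noteq> {} \<and> (\<forall>e. e \<in># edges G \<longrightarrow> e \<subseteq> verts G \<and> card e \<in> {1, 2}))" (is "?b' = ?b")
  proof -
    have c: "card {a, b} \<in> {1, 2}" "card {a, v} = 2" "card {v, b} = 2" using a b by (auto simp: card_insert_if)
    let ?Q = "\<lambda>W F. \<forall>e. e \<in># F \<longrightarrow> e \<subseteq> W \<and> card e \<in> {1, 2}"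
    have "?Q (insert v (verts G)) E \<longleftrightarrow> ?Q (verts G) E"
      using E by blast
    moreover have "{a, v} \<subseteq> insert v (verts G) \<and> {v, b} \<subseteq> insert v (verts G) \<longleftrightarrow> {a, b} \<subseteq> verts G"
      using a b by blast
    moreover have "{a, b} \<subseteq> verts G \<Longrightarrow> verts G \<noteq> {}" by blast
    ultimately show ?thesis using c unfolding eG eG' vG' all_add_mset by (metis finite_insert insertI1 insertI2 insert_not_empty)
  qed
  have conn: "connected_graph G' \<longleftrightarrow> connected_graph G" if ?b
  proof
    have aG: "a \<in> verts G" using that by (auto simp: eG)
    \<comment> \<open>Identifying \<open>v\<close> with \<open>a\<close> contracts one half of the
      subdivided edge, so walks in \<open>G'\<close> project to walks in \<open>G\<close>.\<close>
    define f where "f = (\<lambda>x. if x = v then a else x)"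
    have 1: "(adjacent G)\<^sup>*\<^sup>* (f x) (f y)" if "adjacent G' x y" for x y
    proof -
      have "{x, y} \<in># E \<or> {x, y} = {a, v} \<or> {x, y} = {v, b}" using that by (auto simp: adjacent_def eG')
      moreover have ?thesis if "{x, y} \<in># E"
        using E[OF that] that by (auto simp: f_def adjacent_def eG intro!: r_into_rtranclp)
      moreover have "f x = a \<and> f y = a" if "{x, y} = {a, v}" using that a by (auto simp: f_def doubleton_eq_iff)
      moreover have "f x = a \<and> f y = b \<or> f x = b \<and> f y = a" if "{x, y} = {v, b}"
        using that b by (auto simp: f_def doubleton_eq_iff)
      moreover have "adjacent G a b" "adjacent G b a" by (simp_all add: adjacent_def eG insert_commute)
      ultimately show ?thesis by auto
    qed
    {
      assume c: "connected_graph G'"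
      show "connected_graph G" unfolding connected_graph_def
      proof (intro ballI)
        fix x y assume xy: "x \<in> verts G" "y \<in> verts G"
        then have "(adjacent G')\<^sup>*\<^sup>* x y" using c by (auto simp: connected_graph_def vG')
        from rtranclp_image[of "adjacent G'" "adjacent G" f, OF 1 this]
        show "(adjacent G)\<^sup>*\<^sup>* x y" using xy v by (auto simp: f_def split: if_splits)
      qed
    }
    assume c: "connected_graph G"
    have av: "adjacent G' a v" and vb: "adjacent G' v b" by (simp_all add: adjacent_def eG')
    have 2: "(adjacent G')\<^sup>*\<^sup>* x y" if "adjacent G x y" for x y
    proof -
      have "{x, y} \<in># E \<or> {x, y} = {a, b}" using that by (auto simp: adjacent_def eG)
      then show ?thesis
      proof
        assume "{x, y} \<in># E"
        then show ?thesis by (auto simp: adjacent_def eG')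
      next
        assume "{x, y} = {a, b}"
        moreover have "(adjacent G')\<^sup>*\<^sup>* a b" using av vb by (rule rtranclp_two_steps)
        moreover from this have "(adjacent G')\<^sup>*\<^sup>* b a" by (rule adjacent_rtranclp_sym)
        ultimately show ?thesis by (auto simp: doubleton_eq_iff)
      qed
    qed
    have 3: "(adjacent G')\<^sup>*\<^sup>* a x" if "x \<in> verts G'" for x
    proof (cases "x = v")
      case False
      then have "(adjacent G)\<^sup>*\<^sup>* a x" using c that aG by (auto simp: connected_graph_def vG')
      from rtranclp_image[of "adjacent G" "adjacent G'" "\<lambda>x. x", OF 2 this] show ?thesis by simp
    qed (use av in auto)
    show "connected_graph G'" unfolding connected_graph_def
      by (auto intro: rtranclp_trans[OF adjacent_rtranclp_sym[OF 3] 3])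
  qed
  show "weighted_graph G' \<longleftrightarrow> weighted_graph G"
    using basic conn unfolding weighted_graph_def by blast
qed

text \<open>The bound on \<open>deg G a\<close> is what makes an outer blowup admissible: at a
  vertex of degree at least 2 it would increase the total branching number.\<close>

lemma outer_shape:
  assumes v: "v \<notin> verts G" and vG': "verts G' = insert v (verts G)"
    and eG': "edges G' = add_mset {a, v} (edges G)" and E: "\<And>e. e \<in># edges G \<Longrightarrow> v \<notin> e"
    and aG: "a \<in> verts G"
  shows "weighted_graph G' \<longleftrightarrow> weighted_graph G"
    "deg G a \<le> 1 \<Longrightarrow> branching_points G' = branching_points G"
    "deg G a \<le> 1 \<Longrightarrow> total_branching G' = total_branching G"
proof -
  have a: "a \<noteq> v" using aG v by blast
  have d: "deg G' u = deg G u + of_bool (u = a)" if "u \<in> verts G" for u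
    using that v by (auto simp: deg_mdeg eG')
  have "mdeg (edges G) v = 0" using E by (auto simp: mdeg_zero_iff)
  then have dv: "deg G' v \<le> 2" using a by (auto simp: deg_mdeg eG')
  show "branching_points G' = branching_points G" "total_branching G' = total_branching G" if "deg G a \<le> 1"
    using branching_points_eq[OF v vG' dv] d that by auto
  have basic: "(finite (verts G') \<and> verts G' \<noteq> {} \<and> (\<forall>e. e \<in># edges G' \<longrightarrow> e \<subseteq> verts G' \<and> card e \<in> {1, 2}))
    \<longleftrightarrow> (finite (verts G) \<and> verts G \<noteq> {} \<and> (\<forall>e. e \<in># edges G \<longrightarrow> e \<subseteq> verts G \<and> card e \<in> {1, 2}))"
  proof -
    have c: "card {a, v} = 2" using a by (auto simp: card_insert_if)
    let ?Q = "\<lambda>W F. \<forall>e. e \<in># F \<longrightarrow> e \<subseteq> W \<and> card e \<in> {1, 2}"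
    have "?Q (insert v (verts G)) (edges G) \<longleftrightarrow> ?Q (verts G) (edges G)"
      using E by blast
    moreover have "{a, v} \<subseteq> insert v (verts G)" "verts G \<noteq> {}"
      using aG by blast+
    ultimately show ?thesis using c unfolding eG' vG' all_add_mset by (metis finite_insert insertI1 insertI2 insert_not_empty)
  qed
  have conn: "connected_graph G' \<longleftrightarrow> connected_graph G"
  proof
    define f where "f = (\<lambda>x. if x = v then a else x)"
    have 1: "(adjacent G)\<^sup>*\<^sup>* (f x) (f y)" if "adjacent G' x y" for x y
    proof -
      have "{x, y} \<in># edges G \<or> {x, y} = {a, v}" using that by (auto simp: adjacent_def eG')
      moreover have ?thesis if "{x, y} \<in># edges G"
        using E[OF that] that by (auto simp: f_def adjacent_def intro!: r_into_rtranclp)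
      moreover have "f x = a \<and> f y = a" if "{x, y} = {a, v}" using that a by (auto simp: f_def doubleton_eq_iff)
      ultimately show ?thesis by auto
    qed
    {
      assume c: "connected_graph G'"
      show "connected_graph G" unfolding connected_graph_def
      proof (intro ballI)
        fix x y assume xy: "x \<in> verts G" "y \<in> verts G"
        then have "(adjacent G')\<^sup>*\<^sup>* x y" using c by (auto simp: connected_graph_def vG')
        from rtranclp_image[of "adjacent G'" "adjacent G" f, OF 1 this]
        show "(adjacent G)\<^sup>*\<^sup>* x y" using xy v by (auto simp: f_def split: if_splits)
      qed
    }
    assume c: "connected_graph G"
    have av: "adjacent G' a v" by (simp add: adjacent_def eG')
    have 2: "(adjacent G')\<^sup>*\<^sup>* x y" if "adjacent G x y" for x y
      using that by (auto simp: adjacent_def eG')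
    have 3: "(adjacent G')\<^sup>*\<^sup>* a x" if "x \<in> verts G'" for x
    proof (cases "x = v")
      case False
      then have "(adjacent G)\<^sup>*\<^sup>* a x" using c that aG by (auto simp: connected_graph_def vG')
      from rtranclp_image[of "adjacent G" "adjacent G'" "\<lambda>x. x", OF 2 this] show ?thesis by simp
    qed (use av in auto)
    show "connected_graph G'" unfolding connected_graph_def
      by (auto intro: rtranclp_trans[OF adjacent_rtranclp_sym[OF 3] 3])
  qed
  show "weighted_graph G' \<longleftrightarrow> weighted_graph G"
    using basic conn unfolding weighted_graph_def by blast
qed

text \<open>The sort \<open>infinite\<close> supplies the new vertex.\<close>

lemma inner_up:
  fixes G :: "'v::infinite wgraph"
  assumes G: "weighted_graph G" and eG: "edges G = add_mset {a, b} E"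
  obtains v G' where "v \<notin> verts G" "weighted_graph G'" "inner_step G G'"
    "branching_points G' = branching_points G" "verts G' = insert v (verts G)"
    "edges G' = add_mset {a, v} (add_mset {v, b} E)" "weight G' v = -1"
    "\<And>u. u \<in> verts G \<Longrightarrow> weight G' u = weight G u - of_bool (u = a) - of_bool (u = b)"
proof -
  obtain v where v: "v \<notin> verts G" using ex_new_if_finite[OF infinite_UNIV weighted_graphD(1)[OF G]] by blast
  define G' where "G' = \<lparr>verts = insert v (verts G), edges = add_mset {a, v} (add_mset {v, b} E),
    weight = (\<lambda>u. if u = v then -1 else weight G u - of_bool (u = a) - of_bool (u = b))\<rparr>"
  have sub: "\<And>e. e \<in># edges G \<Longrightarrow> e \<subseteq> verts G" using weighted_graphD(3)[OF G] .
  have E: "v \<notin> e" if "e \<in># E" for e using sub[of e] that v eG by auto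
  have ab: "a \<noteq> v" "b \<noteq> v" using sub[of "{a, b}"] v eG by auto
  have i: "inner_blowup G G'" unfolding inner_blowup_def
    by (intro conjI exI[of _ a] exI[of _ b] exI[of _ E] exI[of _ v]) (use G eG v in \<open>auto simp: G'_def\<close>)
  have vG': "verts G' = insert v (verts G)" and eG': "edges G' = add_mset {a, v} (add_mset {v, b} E)"
    by (simp_all add: G'_def)
  note sh = inner_shape[OF v eG vG' eG' E ab]
  have st: "inner_step G G'" using i sh(3) by (simp add: inner_step_def admissible_step_def blowup_def)
  have wG': "weighted_graph G'" using sh(1) G by simp
  show ?thesis by (rule that[OF v wG' st sh(2) vG' eG']) (use v in \<open>auto simp: G'_def\<close>)
qed

lemma inner_down:
  assumes G': "weighted_graph G'" and eG': "edges G' = add_mset {a, v} (add_mset {v, b} E)"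
    and E: "\<And>e. e \<in># E \<Longrightarrow> v \<notin> e" and ab: "a \<noteq> v" "b \<noteq> v" and w: "weight G' v = -1"
  obtains G where "weighted_graph G" "blowdown G' G" "inner_step G' G"
    "branching_points G = branching_points G'" "verts G = verts G' - {v}"
    "edges G = add_mset {a, b} E"
    "\<And>u. u \<in> verts G \<Longrightarrow> weight G u = weight G' u + of_bool (u = a) + of_bool (u = b)"
proof -
  define G where "G = \<lparr>verts = verts G' - {v}, edges = add_mset {a, b} E,
    weight = (\<lambda>u. weight G' u + of_bool (u = a) + of_bool (u = b))\<rparr>"
  have "v \<in> verts G'" using weighted_graphD(3)[OF G', of "{a, v}"] eG' by auto
  then have vG': "verts G' = insert v (verts G)" by (auto simp: G_def)
  have v: "v \<notin> verts G" and eG: "edges G = add_mset {a, b} E" by (auto simp: G_def)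
  note sh = inner_shape[OF v eG vG' eG' E ab]
  have G: "weighted_graph G" and bp: "branching_points G = branching_points G'" "total_branching G = total_branching G'"
    using sh G' by simp_all
  have wt: "\<forall>u\<in>verts G. weight G' u = weight G u - of_bool (u = a) - of_bool (u = b)"
    by (simp add: G_def)
  have "inner_blowup G G'" unfolding inner_blowup_def
    by (intro conjI exI[of _ a] exI[of _ b] exI[of _ E] exI[of _ v]) (fact G eG v vG' eG' w wt)+
  then have bd: "blowdown G' G" by (simp add: blowdown_def blowup_def)
  then have "inner_step G' G" using bp by (simp add: inner_step_def admissible_step_def)
  then show ?thesis by (rule that[OF G bd _ bp(1)]) (simp_all add: G_def)
qed

lemma outer_up:
  fixes G :: "'v::infinite wgraph"
  assumes G: "weighted_graph G" and a: "a \<in> verts G" "deg G a \<le> 1"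
  obtains v G' where "v \<notin> verts G" "weighted_graph G'" "admissible_step G G'"
    "branching_points G' = branching_points G" "verts G' = insert v (verts G)"
    "edges G' = add_mset {a, v} (edges G)" "weight G' v = -1"
    "\<And>u. u \<in> verts G \<Longrightarrow> weight G' u = weight G u - of_bool (u = a)"
proof -
  obtain v where v: "v \<notin> verts G" using ex_new_if_finite[OF infinite_UNIV weighted_graphD(1)[OF G]] by blast
  define G' where "G' = \<lparr>verts = insert v (verts G), edges = add_mset {a, v} (edges G),
    weight = (\<lambda>u. if u = v then -1 else weight G u - of_bool (u = a))\<rparr>"
  have E: "\<And>e. e \<in># edges G \<Longrightarrow> v \<notin> e" using weighted_graphD(3)[OF G] v by blast
  have i: "outer_blowup G G'" unfolding outer_blowup_def
    by (intro conjI exI[of _ a] exI[of _ v]) (use G a v in \<open>auto simp: G'_def\<close>)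
  have vG': "verts G' = insert v (verts G)" and eG': "edges G' = add_mset {a, v} (edges G)"
    by (simp_all add: G'_def)
  have wG': "weighted_graph G'" and bp: "branching_points G' = branching_points G"
    and tb: "total_branching G' = total_branching G"
    using outer_shape[OF v vG' eG' _ a(1)] E G a(2) by blast+
  have st: "admissible_step G G'" using i tb by (simp add: admissible_step_def blowup_def)
  show ?thesis by (rule that[OF v wG' st bp vG' eG']) (use v in \<open>auto simp: G'_def\<close>)
qed

text \<open>Contracting an end vertex attached to a branching point changes the total branching
  number, hence the condition on the degree of \<open>a\<close>. The plain \<open>blowdown\<close>
  is provided unconditionally because minimality excludes inadmissible blowdowns as well.\<close>

lemma outer_down:
  assumes G': "weighted_graph G'" and eG': "edges G' = add_mset {a, v} E"
    and E: "\<And>e. e \<in># E \<Longrightarrow> v \<notin> e" and av: "a \<noteq> v" and w: "weight G' v = -1"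
  obtains G where "weighted_graph G" "blowdown G' G"
    "deg G' a \<le> 2 \<Longrightarrow> inner_step G' G"
    "deg G' a \<le> 2 \<Longrightarrow> branching_points G = branching_points G'" "verts G = verts G' - {v}"
    "edges G = E" "\<And>u. u \<in> verts G \<Longrightarrow> weight G u = weight G' u + of_bool (u = a)"
proof -
  define G where "G = \<lparr>verts = verts G' - {v}, edges = E,
    weight = (\<lambda>u. weight G' u + of_bool (u = a))\<rparr>"
  have aG': "{a, v} \<subseteq> verts G'" using weighted_graphD(3)[OF G', of "{a, v}"] eG' by auto
  then have vG': "verts G' = insert v (verts G)" by (auto simp: G_def)
  have v: "v \<notin> verts G" and aG: "a \<in> verts G" using aG' av by (auto simp: G_def)
  have eG: "edges G = E" by (simp add: G_def)
  note sh = outer_shape[OF v vG' eG'[folded eG] _ aG, unfolded eG, OF E]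
  have G: "weighted_graph G" using sh G' by simp
  have bp: "branching_points G = branching_points G'" "total_branching G = total_branching G'" if "deg G' a \<le> 2"
  proof -
    have "deg G a \<le> 1" using that av by (simp add: deg_mdeg eG eG')
    then show "branching_points G = branching_points G'" "total_branching G = total_branching G'"
      using sh by simp_all
  qed
  have wt: "\<forall>u\<in>verts G. weight G' u = weight G u - of_bool (u = a)"
    by (simp add: G_def)
  have "outer_blowup G G'" unfolding outer_blowup_def
    by (intro conjI exI[of _ a] exI[of _ v]) (fact G aG v vG' eG'[folded eG] w wt)+
  then have bd: "blowdown G' G" by (simp add: blowdown_def blowup_def)
  then have st: "inner_step G' G" if "deg G' a \<le> 2"
    using bp[OF that] by (simp add: inner_step_def admissible_step_def)
  show ?thesis by (rule that[OF G bd st bp(1)]) (simp_all add: G_def)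
qed

section \<open>Lifting list steps to circular graphs\<close>

definition circle_on :: "'v wgraph \<Rightarrow> 'v list \<Rightarrow> bool" where
  "circle_on G cs \<longleftrightarrow> weighted_graph G \<and> cs \<noteq> [] \<and> distinct cs \<and> set cs = verts G \<and>
     edges G = path_edges (cs @ [hd cs])"

lemma is_circle_circle_on:
  assumes "weighted_graph G"
  shows "is_circle G ws \<longleftrightarrow> (\<exists>cs. circle_on G cs \<and> map (weight G) cs = ws)"
proof -
  have "mset (map2 (\<lambda>a b. {a, b}) cs (rotate1 cs)) = path_edges (cs @ [hd cs])" if "cs \<noteq> []" for cs :: "'a list"
    using mset_circle[of "hd cs" "tl cs"] hd_Cons_tl[OF that] by (metis append_Cons)
  then show ?thesis unfolding is_circle_def circle_on_def using assms by metis
qed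

lemma circle_on_rotate:
  assumes "circle_on G (x # xs)"
  shows "circle_on G (xs @ [x])"
proof (cases xs)
  case (Cons y ys)
  then have "path_edges ((xs @ [x]) @ [hd (xs @ [x])]) = path_edges (x # xs @ [x])"
    by (subst path_edges_snoc) auto
  then show ?thesis using assms Cons unfolding circle_on_def by auto
qed (use assms in simp)

lemma circle_up:
  fixes G :: "'v::infinite wgraph"
  assumes c: "circle_on G (u @ [a, b] @ w)"
  obtains v G' where "inner_step G G'" "circle_on G' (u @ [a, v, b] @ w)"
    "map (weight G') (u @ [a, v, b] @ w) =
       map (weight G) u @ [weight G a - 1, -1, weight G b - 1] @ map (weight G) w"
proof -
  \<comment> \<open>The vertex at which the circle closes: the head of \<open>u\<close>, or
    \<open>a\<close> if \<open>u\<close> is empty. The new vertex comes after it, so the closing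
    edge is unaffected.\<close>
  let ?h = "hd (u @ [a])"
  have h: "hd (u @ [a, b] @ w) = ?h" "hd (u @ [a, v, b] @ w) = ?h" for v by (cases u; simp)+
  have G: "weighted_graph G" and d: "distinct (u @ [a, b] @ w)" and vG: "verts G = set (u @ [a, b] @ w)"
    using c by (auto simp: circle_on_def)
  have eG: "edges G = add_mset {a, b} (path_edges (u @ [a]) + path_edges (b # w @ [?h]))"
    using c path_edges_mid[of u a b "w @ [?h]"] h by (simp add: circle_on_def)
  obtain v G' where s: "v \<notin> verts G" "weighted_graph G'" "inner_step G G'"
    "verts G' = insert v (verts G)"
    "edges G' = add_mset {a, v} (add_mset {v, b} (path_edges (u @ [a]) + path_edges (b # w @ [?h])))"
    "weight G' v = -1" "\<And>u. u \<in> verts G \<Longrightarrow> weight G' u = weight G u - of_bool (u = a) - of_bool (u = b)"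
    using inner_up[OF G eG] by metis
  have "circle_on G' (u @ [a, v, b] @ w)"
    unfolding circle_on_def h using s d vG path_edges_mid3[of u a v b "w @ [?h]"] by auto
  moreover have "map (weight G') (u @ [a, v, b] @ w) =
       map (weight G) u @ [weight G a - 1, -1, weight G b - 1] @ map (weight G) w"
    using s(6,7) d by (auto simp: vG)
  ultimately show ?thesis using that s(3) by blast
qed

lemma circle_down:
  assumes c: "circle_on G (u @ [a, v, b] @ w)" and wv: "weight G v = -1"
  obtains G' where "inner_step G G'" "circle_on G' (u @ [a, b] @ w)"
    "map (weight G') (u @ [a, b] @ w) =
       map (weight G) u @ [weight G a + 1, weight G b + 1] @ map (weight G) w"
proof -
  let ?h = "hd (u @ [a])"
  have h: "hd (u @ [a, b] @ w) = ?h" "hd (u @ [a, v, b] @ w) = ?h" for v by (cases u; simp)+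
  have hin: "?h \<in> set (u @ [a])" by (rule hd_in_set) simp
  have G: "weighted_graph G" and d: "distinct (u @ [a, v, b] @ w)" and vG: "verts G = set (u @ [a, v, b] @ w)"
    using c by (auto simp: circle_on_def)
  have eG: "edges G = add_mset {a, v} (add_mset {v, b} (path_edges (u @ [a]) + path_edges (b # w @ [?h])))"
    using c path_edges_mid3[of u a v b "w @ [?h]"] h by (simp add: circle_on_def)
  have E: "v \<notin> e" if "e \<in># path_edges (u @ [a]) + path_edges (b # w @ [?h])" for e
    using that path_edges_subset[of e "u @ [a]"] path_edges_subset[of e "b # w @ [?h]"] d hin by fastforce
  have ab: "a \<noteq> v" "b \<noteq> v" using d by auto
  obtain G' where s: "weighted_graph G'" "blowdown G G'" "inner_step G G'"
    "verts G' = verts G - {v}" "edges G' = add_mset {a, b} (path_edges (u @ [a]) + path_edges (b # w @ [?h]))"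
    "\<And>u. u \<in> verts G' \<Longrightarrow> weight G' u = weight G u + of_bool (u = a) + of_bool (u = b)"
    using inner_down[OF G eG E ab wv] by metis
  have vG': "verts G' = set (u @ [a, b] @ w)" using d by (auto simp: s(4) vG)
  have "circle_on G' (u @ [a, b] @ w)"
    unfolding circle_on_def h using s(1,5) d vG' path_edges_mid[of u a b "w @ [?h]"] by auto
  moreover have "map (weight G') (u @ [a, b] @ w) =
       map (weight G) u @ [weight G a + 1, weight G b + 1] @ map (weight G) w"
    using s(6) d by (auto simp: vG')
  ultimately show ?thesis using that s(3) by blast
qed

lemma circle_loop_up:
  fixes G :: "'v::infinite wgraph"
  assumes c: "circle_on G [a]"
  obtains v G' where "inner_step G G'" "circle_on G' [a, v]" "map (weight G') [a, v] = [weight G a - 2, -1]"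
proof -
  have G: "weighted_graph G" and eG: "edges G = add_mset {a, a} {#}" and vG: "verts G = {a}"
    using c by (auto simp: circle_on_def)
  obtain v G' where s: "v \<notin> verts G" "weighted_graph G'" "inner_step G G'"
    "verts G' = insert v (verts G)" "edges G' = add_mset {a, v} (add_mset {v, a} {#})"
    "weight G' v = -1" "\<And>u. u \<in> verts G \<Longrightarrow> weight G' u = weight G u - of_bool (u = a) - of_bool (u = a)"
    using inner_up[OF G eG] by metis
  have "circle_on G' [a, v]" "map (weight G') [a, v] = [weight G a - 2, -1]"
    using s vG by (auto simp: circle_on_def)
  then show ?thesis by (rule that[OF s(3)])
qed

lemma circle_loop_down:
  assumes c: "circle_on G [a, v]" and wv: "weight G v = -1"
  obtains G' where "inner_step G G'" "circle_on G' [a]" "map (weight G') [a] = [weight G a + 2]"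
proof -
  have G: "weighted_graph G" and eG: "edges G = add_mset {a, v} (add_mset {v, a} {#})" and vG: "verts G = {a, v}"
    and av: "a \<noteq> v"
    using c by (auto simp: circle_on_def)
  obtain G' where s: "weighted_graph G'" "blowdown G G'" "inner_step G G'"
    "verts G' = verts G - {v}" "edges G' = add_mset {a, a} {#}"
    "\<And>u. u \<in> verts G' \<Longrightarrow> weight G' u = weight G u + of_bool (u = a) + of_bool (u = a)"
    using inner_down[OF G eG _ av av wv] by (metis empty_iff set_mset_empty)
  have "circle_on G' [a]" "map (weight G') [a] = [weight G a + 2]"
    using s vG av by (auto simp: circle_on_def)
  then show ?thesis by (rule that[OF s(3)])
qed

lemma circle_step_lift:
  fixes G :: "'v::infinite wgraph"
  assumes "circle_step ws ws'" "circle_on G cs" "map (weight G) cs = ws"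
  shows "\<exists>G' cs'. inner_step\<^sup>*\<^sup>* G G' \<and> circle_on G' cs' \<and> map (weight G') cs' = ws'"
  using assms
proof (induction rule: circle_step.induct)
  case (mid xs ys)
  from mid(1) show ?case
  proof cases
    case (up u x y v)
    with mid(3) obtain u' a b v' where cs: "cs = u' @ [a, b] @ v'" and w: "map (weight G) u' = u"
      "weight G a = x" "weight G b = y" "map (weight G) v' = v"
      by (auto simp: map_eq_append_conv map_eq_Cons_conv)
    show ?thesis using circle_up[OF mid(2)[unfolded cs]] w up by (metis r_into_rtranclp)
  next
    case (down u x y v)
    with mid(3) obtain u' a c b v' where cs: "cs = u' @ [a, c, b] @ v'" and w: "map (weight G) u' = u"
      "weight G a = x" "weight G b = y" "weight G c = -1" "map (weight G) v' = v"
      by (auto simp: map_eq_append_conv map_eq_Cons_conv)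
    show ?thesis using circle_down[OF mid(2)[unfolded cs] w(4)] w down by (metis r_into_rtranclp)
  qed
next
  case (rot x xs)
  then obtain a as where cs: "cs = a # as" "weight G a = x" "map (weight G) as = xs"
    by (auto simp: map_eq_Cons_conv)
  then show ?case using circle_on_rotate[of G a as] rot
    by (intro exI[of _ G] exI[of _ "as @ [a]"]) auto
next
  case (loop_up x)
  then obtain a where "cs = [a]" "weight G a = x" by (auto simp: map_eq_Cons_conv)
  then show ?case using circle_loop_up[of G a] loop_up(1) by (metis r_into_rtranclp)
next
  case (loop_down x)
  then obtain a v where "cs = [a, v]" "weight G a = x" "weight G v = -1" by (auto simp: map_eq_Cons_conv)
  then show ?case using circle_loop_down[of G a v] loop_down(1) by (metis r_into_rtranclp)
qed

lemma circle_steps_lift: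
  fixes G :: "'v::infinite wgraph"
  assumes "circle_step\<^sup>*\<^sup>* ws ws'" "circle_on G cs" "map (weight G) cs = ws"
  shows "\<exists>G' cs'. inner_step\<^sup>*\<^sup>* G G' \<and> circle_on G' cs' \<and> map (weight G') cs' = ws'"
  using assms(1)
proof (induction rule: rtranclp_induct)
  case base
  then show ?case using assms(2,3) by blast
next
  case (step y z)
  then obtain G' cs' where 1: "inner_step\<^sup>*\<^sup>* G G'" "circle_on G' cs'" "map (weight G') cs' = y" by blast
  obtain G'' cs'' where "inner_step\<^sup>*\<^sup>* G' G''" "circle_on G'' cs''" "map (weight G'') cs'' = z"
    using circle_step_lift[OF step(2) 1(2,3)] by blast
  then show ?case using rtranclp_trans[OF 1(1)] by blast
qed

section \<open>Lifting list steps to linear segments\<close>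

text \<open>The lists \<open>L\<close> and \<open>R\<close> hold the branching point to which the respective end of the segment
  \<open>vs\<close> is joined; they are empty at a free end.\<close>

definition seg :: "'v wgraph \<Rightarrow> 'v set \<Rightarrow> 'v list \<Rightarrow> 'v list \<Rightarrow> 'v list \<Rightarrow> 'v set multiset \<Rightarrow> bool" where
  "seg G A L vs R E \<longleftrightarrow> weighted_graph G \<and> verts G = A \<union> set vs \<and> A \<inter> set vs = {} \<and> distinct vs \<and> vs \<noteq> [] \<and>
     edges G = path_edges (L @ vs @ R) + E \<and> (\<forall>e. e \<in># E \<longrightarrow> e \<subseteq> A) \<and>
     set L \<union> set R \<subseteq> A \<inter> branching_points G \<and> length L \<le> 1 \<and> length R \<le> 1"

lemma seg_rev:
  assumes "seg G A L vs R E"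
  shows "seg G A R (rev vs) L E"
proof -
  have "rev L = L" "rev R = R" using assms by (auto simp: seg_def length_Suc_conv le_Suc_eq)
  then have "path_edges (R @ rev vs @ L) = path_edges (L @ vs @ R)"
    using path_edges_rev[of "L @ vs @ R"] by simp
  then show ?thesis using assms by (auto simp: seg_def)
qed

text \<open>Branching points are exempt from the condition on weights, since steps beyond the end of
  a segment change their weights.\<close>

definition keeps :: "'v set \<Rightarrow> 'v wgraph \<Rightarrow> 'v wgraph \<Rightarrow> bool" where
  "keeps A G G' \<longleftrightarrow> branching_points G' = branching_points G \<and>
     (\<forall>u\<in>A - branching_points G. weight G' u = weight G u)"

lemma keeps_trans: "keeps A G G' \<Longrightarrow> keeps A G' G'' \<Longrightarrow> keeps A G G''"
  by (auto simp: keeps_def)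

text \<open>A boundary step at a free end is an outer blowup, hence not inner; this is why being inner is
  conditional.\<close>

definition lifts :: "bool \<Rightarrow> bool \<Rightarrow> 'v wgraph \<Rightarrow> 'v set \<Rightarrow> 'v list \<Rightarrow> 'v list \<Rightarrow> 'v set multiset \<Rightarrow> int list \<Rightarrow> bool" where
  "lifts pl pr G A L R E ws \<longleftrightarrow> (\<exists>G' vs. seg G' A L vs R E \<and> map (weight G') vs = ws \<and> keeps A G G' \<and>
     admissible_step G G' \<and> ((pl \<longrightarrow> L \<noteq> []) \<and> (pr \<longrightarrow> R \<noteq> []) \<longrightarrow> inner_step G G'))"

lemma lifts_rev:
  assumes "lifts pl pr G A L R E ws"
  shows "lifts pr pl G A R L E (rev ws)"
proof -
  obtain G' vs where "seg G' A L vs R E" "map (weight G') vs = ws" "keeps A G G'"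
     "admissible_step G G'" "(pl \<longrightarrow> L \<noteq> []) \<and> (pr \<longrightarrow> R \<noteq> []) \<longrightarrow> inner_step G G'"
    using assms unfolding lifts_def by blast
  then show ?thesis unfolding lifts_def
    using seg_rev[of G' A L vs R E] by (intro exI[of _ G'] exI[of _ "rev vs"]) (auto simp: rev_map)
qed

lemma segD:
  assumes "seg G A L vs R E"
  shows "weighted_graph G" "verts G = A \<union> set vs" "A \<inter> set vs = {}" "distinct vs" "vs \<noteq> []"
    "edges G = path_edges (L @ vs @ R) + E" "e \<in># E \<Longrightarrow> e \<subseteq> A" "set L \<subseteq> A" "set R \<subseteq> A"
    "set L \<subseteq> branching_points G" "set R \<subseteq> branching_points G" "length L \<le> 1" "length R \<le> 1"
  using assms by (auto simp: seg_def)

lemma inner_step_admissible: "inner_step G G' \<Longrightarrow> admissible_step G G'"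
  by (simp add: inner_step_def)

text \<open>The decomposition into \<open>P\<close> and \<open>Q\<close> refers to the path
  including \<open>L\<close> and \<open>R\<close>, so edges inside the segment and the edges to
  branching points are covered at once. An end of the edge that lies outside the segment is a
  branching point, whose weight \<open>keeps\<close> ignores.\<close>

lemma seg_up:
  fixes G :: "'v::infinite wgraph"
  assumes s: "seg G A L vs R E" and p: "L @ vs @ R = P @ [a, b] @ Q"
    and p': "\<And>v. L @ vs' v @ R = P @ [a, v, b] @ Q" and vs': "\<And>v. vs' v \<noteq> []"
    and ws: "\<And>f v. (\<forall>u\<in>set vs. f u = weight G u - of_bool (u = a) - of_bool (u = b)) \<Longrightarrow> f v = -1 \<Longrightarrow> map f (vs' v) = ws"
    and ab: "{a, b} \<inter> A \<subseteq> branching_points G"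
    and perm: "\<And>v. mset (vs' v) = add_mset v (mset vs)"
  shows "lifts pl pr G A L R E ws"
proof -
  note sD = segD[OF s]
  have eG: "edges G = add_mset {a, b} (path_edges (P @ [a]) + path_edges (b # Q) + E)"
    unfolding sD(6) p path_edges_mid by simp
  obtain v G' where G': "v \<notin> verts G" "weighted_graph G'" "inner_step G G'"
    "branching_points G' = branching_points G" "verts G' = insert v (verts G)"
    "edges G' = add_mset {a, v} (add_mset {v, b} (path_edges (P @ [a]) + path_edges (b # Q) + E))" "weight G' v = -1"
    "\<And>u. u \<in> verts G \<Longrightarrow> weight G' u = weight G u - of_bool (u = a) - of_bool (u = b)"
    using inner_up[OF sD(1) eG] by blast
  have set': "set (vs' v) = insert v (set vs)" using perm[of v] by (metis set_mset_add_mset_insert set_mset_mset)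
  have d: "distinct (vs' v)" using perm[of v] sD(2,4) G'(1)
    by (metis UnI2 distinct.simps(2) mset.simps(2) mset_eq_imp_distinct_iff)
  have "seg G' A L (vs' v) R E"
    unfolding seg_def using sD vs' G' set' d path_edges_mid3[of P a v b Q] by (auto simp: p')
  moreover have "map (weight G') (vs' v) = ws"
    using G'(7,8) sD(2) by (intro ws) auto
  moreover have "keeps A G G'" unfolding keeps_def using G'(4,8) sD(2) ab by auto
  ultimately show ?thesis unfolding lifts_def using G'(3) inner_step_admissible by blast
qed

lemma seg_down:
  assumes s: "seg G A L vs R E" and p: "L @ vs @ R = P @ [a, v, b] @ Q"
    and p': "L @ vs' @ R = P @ [a, b] @ Q" and vs': "vs' \<noteq> []"
    and v: "v \<notin> set P \<union> {a, b} \<union> set Q" "weight G v = -1"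
    and ws: "\<And>f. (\<forall>u\<in>set vs'. f u = weight G u + of_bool (u = a) + of_bool (u = b)) \<Longrightarrow> map f vs' = ws"
    and ab: "{a, b} \<inter> A \<subseteq> branching_points G"
    and perm: "mset vs = add_mset v (mset vs')"
  shows "lifts pl pr G A L R E ws"
proof -
  note sD = segD[OF s]
  have eG: "edges G = add_mset {a, v} (add_mset {v, b} (path_edges (P @ [a]) + path_edges (b # Q) + E))"
    unfolding sD(6) p path_edges_mid3 by simp
  have sv: "set vs = insert v (set vs')" using perm by (metis set_mset_add_mset_insert set_mset_mset)
  have d: "distinct vs'" "v \<notin> set vs'"
    using perm sD(4) by (metis distinct.simps(2) mset.simps(2) mset_eq_imp_distinct_iff)+
  have nE: "v \<notin> e" if "e \<in># path_edges (P @ [a]) + path_edges (b # Q) + E" for e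
    using that path_edges_subset[of e "P @ [a]"] path_edges_subset[of e "b # Q"] v sD(3) sD(7)[of e] sv by auto
  have "a \<noteq> v" "b \<noteq> v" using v by auto
  from inner_down[OF sD(1) eG nE this v(2)] obtain G' where G': "weighted_graph G'" "inner_step G G'"
    "branching_points G' = branching_points G" "verts G' = verts G - {v}"
    "edges G' = add_mset {a, b} (path_edges (P @ [a]) + path_edges (b # Q) + E)"
    "\<And>u. u \<in> verts G' \<Longrightarrow> weight G' u = weight G u + of_bool (u = a) + of_bool (u = b)"
    by metis
  have vA: "v \<notin> A" using sv sD(3) by auto
  have vG': "verts G' = A \<union> set vs'" using G'(4) sD(2) sv d(2) vA by auto
  have "seg G' A L vs' R E"
    unfolding seg_def using sD vs' G' d vG' sv path_edges_mid[of P a b Q] by (auto simp: p')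
  moreover have "map (weight G') vs' = ws"
    using G'(6) vG' by (intro ws) auto
  moreover have "keeps A G G'" unfolding keeps_def using G'(3,6) vG' ab by auto
  ultimately show ?thesis unfolding lifts_def using G'(2) inner_step_admissible by blast
qed

lemma liftsI:
  "seg G' A L vs R E \<Longrightarrow> map (weight G') vs = ws \<Longrightarrow> keeps A G G' \<Longrightarrow> admissible_step G G' \<Longrightarrow>
    ((pl \<longrightarrow> L \<noteq> []) \<and> (pr \<longrightarrow> R \<noteq> []) \<Longrightarrow> inner_step G G') \<Longrightarrow> lifts pl pr G A L R E ws"
  unfolding lifts_def by blast

lemma path_edges_ends:
  assumes "length L \<le> 1" "length R \<le> 1" "vs \<noteq> []"
  shows "path_edges (L @ vs @ R) = (if L = [] then {#} else {#{hd L, hd vs}#}) + path_edges vs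
    + (if R = [] then {#} else {#{last vs, hd R}#})"
proof -
  have r: "path_edges (vs @ R) = path_edges vs + (if R = [] then {#} else {#{last vs, hd R}#})"
    using assms(2,3) path_edges_snoc[OF assms(3)] by (cases R) auto
  show ?thesis
  proof (cases L)
    case (Cons a L')
    then show ?thesis using assms(1,3) r path_edges_Cons[of "vs @ R" a] by auto
  qed (simp add: r)
qed

lemma seg_deg:
  assumes "seg G A L vs R E" "u \<in> set vs"
  shows "deg G u = of_bool (u \<noteq> hd vs \<or> L \<noteq> []) + of_bool (u \<noteq> last vs \<or> R \<noteq> [])"
proof -
  note sD = segD[OF assms(1)]
  have E: "mdeg E u = 0" using sD(3,7) assms(2) unfolding mdeg_zero_iff by blast
  have "u \<noteq> hd L" if "L \<noteq> []" using sD(3,8) assms(2) hd_in_set[OF that] by blast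
  then have 1: "mdeg (if L = [] then {#} else {#{hd L, hd vs}#}) u = of_bool (L \<noteq> [] \<and> u = hd vs)" by simp
  have "u \<noteq> hd R" if "R \<noteq> []" using sD(3,9) assms(2) hd_in_set[OF that] by blast
  then have 2: "mdeg (if R = [] then {#} else {#{last vs, hd R}#}) u = of_bool (R \<noteq> [] \<and> u = last vs)" by simp
  show ?thesis unfolding deg_mdeg sD(6) path_edges_ends[OF sD(12,13,5)] mdeg_union 1 2 E mdeg_path[OF sD(4) assms(2)]
    by (simp split: split_of_bool)
qed

lemma seg_not_branching: "seg G A L vs R E \<Longrightarrow> u \<in> set vs \<Longrightarrow> u \<notin> branching_points G"
  using seg_deg[of G A L vs R E u] by (simp add: branching_points_def split: split_of_bool)

lemma seg_mid_step:
  fixes G :: "'v::infinite wgraph"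
  assumes s: "seg G A L vs R E" and st: "mid_step ws ws'" and ws: "map (weight G) vs = ws"
  shows "lifts pl pr G A L R E ws'"
proof -
  have d: "distinct vs" "A \<inter> set vs = {}" using segD[OF s] by auto
  from st show ?thesis
  proof cases
    case (up u x y v)
    with ws obtain u' a b v' where cs: "vs = u' @ [a, b] @ v'" and w: "map (weight G) u' = u"
      "weight G a = x" "weight G b = y" "map (weight G) v' = v"
      by (auto simp: map_eq_append_conv map_eq_Cons_conv)
    show ?thesis
    proof (rule seg_up[OF s, of "L @ u'" a b "v' @ R" "\<lambda>c. u' @ [a, c, b] @ v'"])
      show "map f (u' @ [a, c, b] @ v') = ws'"
        if "\<forall>u\<in>set vs. f u = weight G u - of_bool (u = a) - of_bool (u = b)" "f c = -1" for f c
        using that d w unfolding up cs by auto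
    qed (use d in \<open>auto simp: cs\<close>)
  next
    case (down u x y v)
    with ws obtain u' a c b v' where cs: "vs = u' @ [a, c, b] @ v'" and w: "map (weight G) u' = u"
      "weight G a = x" "weight G b = y" "weight G c = -1" "map (weight G) v' = v"
      by (auto simp: map_eq_append_conv map_eq_Cons_conv)
    show ?thesis
    proof (rule seg_down[OF s, of "L @ u'" a c b "v' @ R" "u' @ [a, b] @ v'"])
      show "map f (u' @ [a, b] @ v') = ws'"
        if "\<forall>u\<in>set (u' @ [a, b] @ v'). f u = weight G u + of_bool (u = a) + of_bool (u = b)" for f
        using that d w unfolding down cs by auto
      show "c \<notin> set (L @ u') \<union> {a, b} \<union> set (v' @ R)"
        using d segD(8,9)[OF s] by (auto simp: cs)
    qed (use d w in \<open>auto simp: cs\<close>)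
  qed
qed

lemma seg_left_up:
  fixes G :: "'v::infinite wgraph"
  assumes s: "seg G A L vs R E" and ws: "map (weight G) vs = x # v" and pl: pl
  shows "lifts pl pr G A L R E (-1 # (x - 1) # v)"
proof -
  note sD = segD[OF s]
  obtain b w where cs: "vs = b # w" and w: "weight G b = x" "map (weight G) w = v" using ws by auto
  show ?thesis
  proof (cases L)
    case (Cons a L')
    then have L: "L = [a]" using sD(12) by auto
    then have a: "a \<in> A" "a \<in> branching_points G" using sD by auto
    show ?thesis
    proof (rule seg_up[OF s, of "[]" a b "w @ R" "\<lambda>c. c # b # w"])
      show "map f (c # b # w) = -1 # (x - 1) # v"
        if "\<forall>u\<in>set vs. f u = weight G u - of_bool (u = a) - of_bool (u = b)" "f c = -1" for f c
        using that sD(3,4) w a unfolding cs by auto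
    qed (use sD(3) a in \<open>auto simp: cs L\<close>)
  next
    case Nil
    have b: "b \<in> verts G" "deg G b \<le> 1" using sD(2) seg_deg[OF s, of b] Nil by (auto simp: cs)
    obtain c G' where G': "c \<notin> verts G" "weighted_graph G'" "admissible_step G G'"
      "branching_points G' = branching_points G" "verts G' = insert c (verts G)"
      "edges G' = add_mset {b, c} (edges G)" "weight G' c = -1"
      "\<And>u. u \<in> verts G \<Longrightarrow> weight G' u = weight G u - of_bool (u = b)"
      using outer_up[OF sD(1) b] by metis
    have "seg G' A L (c # vs) R E"
      unfolding seg_def using sD G' by (auto simp: Nil cs insert_commute)
    moreover have "map (weight G') (c # vs) = -1 # (x - 1) # v"
      using G'(7,8) sD(2,4) w by (auto simp: cs)
    moreover have "keeps A G G'" unfolding keeps_def using G'(4,8) sD(2,3) by (auto simp: cs)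
    ultimately show ?thesis by (rule liftsI) (use G'(3) pl Nil in auto)
  qed
qed

lemma seg_left_down:
  fixes G :: "'v::infinite wgraph"
  assumes s: "seg G A L vs R E" and ws: "map (weight G) vs = -1 # x # v"
  shows "lifts pl pr G A L R E ((x + 1) # v)"
proof -
  note sD = segD[OF s]
  obtain c b w where cs: "vs = c # b # w" and w: "weight G c = -1" "weight G b = x" "map (weight G) w = v"
    using ws by (auto simp: map_eq_Cons_conv)
  show ?thesis
  proof (cases L)
    case (Cons a L')
    then have L: "L = [a]" using sD(12) by auto
    then have a: "a \<in> A" "a \<in> branching_points G" using sD by auto
    show ?thesis
    proof (rule seg_down[OF s, of "[]" a c b "w @ R" "b # w"])
      show "map f (b # w) = (x + 1) # v"
        if "\<forall>u\<in>set (b # w). f u = weight G u + of_bool (u = a) + of_bool (u = b)" for f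
        using that sD(3,4) w a unfolding cs by auto
      show "c \<notin> set [] \<union> {a, b} \<union> set (w @ R)"
        using sD(3,4,9) a by (auto simp: cs)
    qed (use sD(3) a w in \<open>auto simp: cs L\<close>)
  next
    case Nil
    have eG: "edges G = add_mset {b, c} (path_edges (b # w @ R) + E)"
      using sD(6) by (simp add: cs Nil insert_commute)
    have nE: "c \<notin> e" if "e \<in># path_edges (b # w @ R) + E" for e
      using that path_edges_subset[of e "b # w @ R"] sD(3,4,9) sD(7)[of e] by (auto simp: cs)
    \<comment> \<open>The neighbour \<open>b\<close> also lies in the segment and has degree at most
      2, so the contraction is admissible. As a blowdown it counts as inner even at a free
      end.\<close>
    have bc: "b \<noteq> c" and b2: "deg G b \<le> 2" using sD(4) seg_deg[OF s, of b] by (auto simp: cs)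
    from outer_down[OF sD(1) eG nE bc w(1)] b2 obtain G' where G': "weighted_graph G'" "inner_step G G'"
      "branching_points G' = branching_points G" "verts G' = verts G - {c}"
      "edges G' = path_edges (b # w @ R) + E"
      "\<And>u. u \<in> verts G' \<Longrightarrow> weight G' u = weight G u + of_bool (u = b)"
      by metis
    have vG': "verts G' = A \<union> set (b # w)" using G'(4) sD(2,3,4) by (auto simp: cs)
    have "seg G' A L (b # w) R E"
      unfolding seg_def using sD G' vG' by (auto simp: Nil cs)
    moreover have "map (weight G') (b # w) = (x + 1) # v"
      using G'(6) vG' sD(4) w by (auto simp: cs)
    moreover have "keeps A G G'" unfolding keeps_def using G'(3,6) sD(3) vG' by (auto simp: cs)
    ultimately show ?thesis by (rule liftsI) (use G'(2) inner_step_admissible in auto)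
  qed
qed

lemma seg_chain_step:
  fixes G :: "'v::infinite wgraph"
  assumes "chain_step pl pr ws ws'" and s: "seg G A L vs R E" and ws: "map (weight G) vs = ws"
  shows "lifts pl pr G A L R E ws'"
proof -
  have rws: "map (weight G) (rev vs) = rev ws" using ws by (simp add: rev_map[symmetric])
  from assms(1) show ?thesis
  proof cases
    case mid
    then show ?thesis using seg_mid_step s ws by blast
  next
    case (left_up b v)
    then show ?thesis using seg_left_up[OF s, of b v pl pr] ws by simp
  next
    case (left_down b v)
    then show ?thesis using seg_left_down[OF s, of b v pl pr] ws by simp
  next
    case (right_up v b)
    then show ?thesis using lifts_rev[OF seg_left_up[OF seg_rev[OF s], of b "rev v" pr pl]] rws by simp
  next
    case (right_down v b)
    then show ?thesis using lifts_rev[OF seg_left_down[OF seg_rev[OF s], of b "rev v" pr pl]] rws by simp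
  qed
qed

text \<open>\<open>T\<close> stands for \<open>inner_step\<close> in the first claim, where a flag
  is set only at an end joined to a branching point, and for \<open>admissible_step\<close> in the
  second, where both flags are set.\<close>

lemma seg_chain_steps:
  fixes G :: "'v::infinite wgraph"
  assumes "(chain_step pl pr)\<^sup>*\<^sup>* ws ws'" and s: "seg G A L vs R E" and ws: "map (weight G) vs = ws"
    and T: "\<And>G G'. admissible_step G G' \<Longrightarrow> ((pl \<longrightarrow> L \<noteq> []) \<and> (pr \<longrightarrow> R \<noteq> []) \<Longrightarrow> inner_step G G') \<Longrightarrow> T G G'"
  shows "\<exists>G' vs'. T\<^sup>*\<^sup>* G G' \<and> seg G' A L vs' R E \<and> map (weight G') vs' = ws' \<and> keeps A G G'"
  using assms(1)
proof (induction rule: rtranclp_induct)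
  case base
  then show ?case using s ws by (auto simp: keeps_def)
next
  case (step y z)
  then obtain G1 v1 where 1: "T\<^sup>*\<^sup>* G G1" "seg G1 A L v1 R E" "map (weight G1) v1 = y" "keeps A G G1" by blast
  obtain G2 v2 where 2: "seg G2 A L v2 R E" "map (weight G2) v2 = z" "keeps A G1 G2" "T G1 G2"
    using seg_chain_step[OF step(2) 1(2,3)] T unfolding lifts_def by metis
  have "T\<^sup>*\<^sup>* G G2" using 1(1) 2(4) by (rule rtranclp.rtrancl_into_rtrancl)
  then show ?case using 2(1,2) keeps_trans[OF 1(4) 2(3)] by blast
qed

section \<open>Segments as components\<close>

lemma path_edges_reach:
  assumes "\<And>e. e \<in># path_edges vs \<Longrightarrow> e \<in># edges G" "u \<in> set vs" "v \<in> set vs"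
  shows "(adjacent G)\<^sup>*\<^sup>* u v"
proof -
  have "\<forall>v\<in>set vs. (adjacent G)\<^sup>*\<^sup>* (hd vs) v" using assms(1)
  proof (induction vs rule: path_edges.induct)
    case (1 x y zs)
    then have "adjacent G x y" by (auto simp: adjacent_def)
    moreover have "\<forall>v\<in>set (y # zs). (adjacent G)\<^sup>*\<^sup>* y v" using 1 by auto
    ultimately show ?case by (auto intro: converse_rtranclp_into_rtranclp)
  qed auto
  then show ?thesis using assms(2,3) adjacent_rtranclp_sym rtranclp_trans by metis
qed

text \<open>Deleting the branching points removes the edges at \<open>L\<close> and
  \<open>R\<close>, and \<open>E\<close> does not touch \<open>vs\<close>, so nothing connects
  \<open>vs\<close> with the rest. The second claim also shows that a segment is determined, as a
  set, by any of its vertices.\<close>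

lemma seg_component:
  assumes s: "seg G A L vs R E" and u: "u \<in> set vs"
  shows "is_chain (component (delete_verts G (branching_points G)) u) (map (weight G) vs)"
    "verts (component (delete_verts G (branching_points G)) u) = set vs"
proof -
  note sD = segD[OF s]
  define B where "B = branching_points G"
  define H where "H = delete_verts G B"
  have BA: "B \<subseteq> A" using sD(2) seg_not_branching[OF s] by (auto simp: B_def branching_points_def)
  have vH: "verts H = (A - B) \<union> set vs"
    using sD(2,3) BA by (auto simp: H_def delete_verts_def)
  have Lm: "hd L \<in> B" if "L \<noteq> []" using sD(10) that hd_in_set by (auto simp: B_def)
  have Rm: "hd R \<in> B" if "R \<noteq> []" using sD(11) that hd_in_set by (auto simp: B_def)
  have pB: "{#e \<in># path_edges vs. e \<inter> B = {}#} = path_edges vs"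
    using path_edges_subset[of _ vs] BA sD(3) by (subst filter_mset_eq_conv) (auto; blast)
  have eH: "edges H = path_edges vs + {#e \<in># E. e \<inter> B = {}#}"
    using Lm Rm pB by (auto simp: H_def delete_verts_def sD(6) path_edges_ends[OF sD(12,13,5)])
  have reach: "(adjacent H)\<^sup>*\<^sup>* u x \<longleftrightarrow> x \<in> set vs" if "x \<in> verts H" for x
  proof
    assume "x \<in> set vs"
    then show "(adjacent H)\<^sup>*\<^sup>* u x" using path_edges_reach[of vs H u x] u eH by auto
  next
    assume "(adjacent H)\<^sup>*\<^sup>* u x"
    then show "x \<in> set vs"
    proof (induction rule: rtranclp_induct)
      case (step y z)
      then have "{y, z} \<in># path_edges vs \<or> {y, z} \<in># E" by (auto simp: adjacent_def eH)
      then show ?case using path_edges_subset[of "{y, z}" vs] sD(7)[of "{y, z}"] sD(3) step by auto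
    qed (use u in simp)
  qed
  have un: "{x \<in> verts H. \<not> (adjacent H)\<^sup>*\<^sup>* u x} = A - B"
    using reach vH sD(3) by auto
  have c: "component H u = \<lparr>verts = set vs, edges = {#e \<in># edges H. e \<inter> (A - B) = {}#}, weight = weight G\<rparr>"
    unfolding component_def un by (auto simp: delete_verts_def vH H_def sD(2)) (use sD(3) BA in auto)
  have "{#e \<in># path_edges vs. e \<inter> (A - B) = {}#} = path_edges vs"
    using path_edges_subset[of _ vs] sD(3) by (subst filter_mset_eq_conv) (auto; blast)
  \<comment> \<open>A surviving edge of \<open>E\<close> is nonempty and lies in \<open>A\<close>
    outside the branching points, so passing to the component deletes it.\<close>
  moreover have "e \<inter> (A - B) \<noteq> {}" if "e \<in># E" "e \<inter> B = {}" for e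
    using sD(7)[OF that(1)] that weighted_graphD(4)[OF sD(1), of e] by (auto simp: sD(6))
  ultimately have e: "edges (component H u) = path_edges vs"
    by (auto simp: c eH)
  show "verts (component (delete_verts G (branching_points G)) u) = set vs"
    using c unfolding H_def B_def by simp
  have "is_chain (component H u) (map (weight G) vs)"
    unfolding is_chain_def mset_path e using sD(4,5) c by (intro exI[of _ vs]) simp
  then show "is_chain (component (delete_verts G (branching_points G)) u) (map (weight G) vs)"
    unfolding H_def B_def .
qed

section \<open>Decomposition into segments\<close>

text \<open>A longest path through \<open>u\<close> among the non-branching vertices cannot be
  extended, so the remaining edges at its ends lead to branching points or back into the path. By
  the degree bound they can only lead back to an end, and then the path closes up to the whole
  graph.\<close>

lemma seg_or_circle:
  assumes G: "weighted_graph G" and u: "u \<in> verts G" "u \<notin> branching_points G"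
  shows "(\<exists>A L vs R E. seg G A L vs R E \<and> u \<in> set vs) \<or> (\<exists>cs. circle_on G cs)"
proof -
  let ?B = "branching_points G"
  define S where "S = {vs. distinct vs \<and> u \<in> set vs \<and> set vs \<subseteq> verts G - ?B \<and> path_edges vs \<subseteq># edges G}"
  have "[u] \<in> S" using u by (simp add: S_def)
  moreover have "length vs \<le> card (verts G)" if "vs \<in> S" for vs
  proof -
    have "card (set vs) \<le> card (verts G)" using that weighted_graphD(1)[OF G] by (intro card_mono) (auto simp: S_def)
    then show ?thesis using that by (simp add: S_def distinct_card)
  qed
  ultimately obtain vs where vs: "vs \<in> S" and mx: "\<And>ys. ys \<in> S \<Longrightarrow> length ys \<le> length vs"
    using ex_has_greatest_nat[of "\<lambda>vs. vs \<in> S" "[u]" length "Suc (card (verts G))"]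
    by (auto simp: less_Suc_eq_le)
  have d: "distinct vs" and uv: "u \<in> set vs" and sub: "set vs \<subseteq> verts G" "set vs \<inter> ?B = {}"
    and pe: "path_edges vs \<subseteq># edges G" using vs by (auto simp: S_def)
  have ne: "vs \<noteq> []" using uv by auto
  obtain F where eG: "edges G = path_edges vs + F" using pe by (metis mset_subset_eq_exists_conv)
  let ?x = "hd vs" and ?y = "last vs"
  have xy: "?x \<in> set vs" "?y \<in> set vs" using ne by auto
  \<comment> \<open>The path uses up the degree of its interior vertices. One further edge may
    remain at each end, or degree 2 at the only vertex of a one-vertex path.\<close>
  have degF: "mdeg F v \<le> of_bool (v = ?x) + of_bool (v = ?y)" if "v \<in> set vs" for v
  proof -
    have "deg G v \<le> 2" using that sub by (fastforce simp: branching_points_def)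
    then show ?thesis using mdeg_path[OF d that] by (auto simp: deg_mdeg eG)
  qed
  have form: "\<exists>z. e = {v, z}" if "e \<in># F" "v \<in> e" for e v
  proof -
    have "card e = 1 \<or> card e = 2" using G that(1) by (auto simp: weighted_graph_def eG)
    then show ?thesis using that(2) by (auto simp: card_1_singleton_iff card_2_iff)
  qed
  have inG: "z \<in> verts G" if "{v, z} \<in># F" for v z
    using weighted_graphD(3)[OF G, of "{v, z}"] that by (auto simp: eG)
  have extl: "z \<in> set vs \<or> z \<in> ?B" if "{?x, z} \<in># F" for z
  proof (rule ccontr)
    assume *: "\<not> ?thesis"
    have "path_edges (z # vs) = add_mset {?x, z} (path_edges vs)"
      using path_edges_Cons[OF ne] by (simp add: insert_commute)
    also have "\<dots> \<subseteq># edges G" using that by (simp add: eG subset_mset.add_increasing2)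
    finally have "z # vs \<in> S" using * vs inG[OF that] by (auto simp: S_def)
    from mx[OF this] show False by simp
  qed
  have extr: "z \<in> set vs \<or> z \<in> ?B" if "{?y, z} \<in># F" for z
  proof (rule ccontr)
    assume *: "\<not> ?thesis"
    have "path_edges (vs @ [z]) = add_mset {?y, z} (path_edges vs)"
      using path_edges_snoc[OF ne] by simp
    also have "\<dots> \<subseteq># edges G" using that by (simp add: eG subset_mset.add_increasing2)
    finally have "vs @ [z] \<in> S" using * vs inG[OF that] by (auto simp: S_def)
    from mx[OF this] show False by simp
  qed
  have touch: "v = ?x \<or> v = ?y" if "e \<in># F" "v \<in> e" "v \<in> set vs" for e v
  proof -
    have "mdeg F v \<noteq> 0" using that by (auto simp: mdeg_zero_iff)
    then show ?thesis using degF[OF that(3)] by (cases "v = ?x"; cases "v = ?y") auto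
  qed
  show ?thesis
  \<comment> \<open>For a one-vertex path this edge is a loop, for a two-vertex path a second
    parallel edge. It exhausts the degrees, so no edge leaves \<open>vs\<close>, and connectedness
    makes \<open>vs\<close> everything.\<close>
  proof (cases "{?y, ?x} \<in># F")
    case True
    then obtain F' where F: "F = add_mset {?y, ?x} F'" by (metis multi_member_split)
    have F': "v \<notin> e" if "v \<in> set vs" "e \<in># F'" for v e
    proof -
      have "mdeg F' v = 0" using degF[OF that(1)] by (simp add: F)
      then show ?thesis using that(2) by (auto simp: mdeg_zero_iff)
    qed
    have cl: "v \<in> set vs" if "(adjacent G)\<^sup>*\<^sup>* u v" for v
      using that
    proof (induction rule: rtranclp_induct)
      case (step v w)
      then have "{v, w} \<in># path_edges vs \<or> {v, w} = {?y, ?x} \<or> {v, w} \<in># F'"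
        by (auto simp: adjacent_def eG F)
      moreover have "w \<in> set vs" if "{v, w} = {?y, ?x}" using that xy by (metis doubleton_eq_iff)
      ultimately show ?case using path_edges_subset[of "{v, w}" vs] F'[OF step(3), of "{v, w}"] by auto
    qed (rule uv)
    then have vG: "verts G = set vs" using weighted_graphD(5)[OF G u(1)] sub by blast
    have "F' = {#}"
    proof (rule ccontr)
      assume "F' \<noteq> {#}"
      then obtain e where e: "e \<in># F'" by blast
      then have "e \<subseteq> set vs" "e \<noteq> {}" using weighted_graphD(3,4)[OF G, of e] vG by (auto simp: eG F)
      then show False using F' e by blast
    qed
    then have "circle_on G vs" using G d ne vG path_edges_snoc[OF ne, of ?x] by (simp add: circle_on_def eG F)
    then show ?thesis by blast
  next
    case False
    have noloop: "{v} \<notin># F" if "v = ?x \<or> v = ?y" for v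
    proof
      assume v: "{v} \<in># F"
      then obtain F' where "F = add_mset {v} F'" by (metis multi_member_split)
      then have "mdeg F v \<ge> 2" by simp
      then have "?x = ?y" using degF[of v] that xy by (cases "?x = ?y") auto
      then show False using False v that by auto
    qed
    have out: "\<exists>b\<in>?B. e = {?x, b} \<or> e = {?y, b}" if e: "e \<in># F" "v \<in> e" "v \<in> set vs" for e v
    proof -
      obtain z where z: "e = {v, z}" using form e by blast
      have v: "v = ?x \<or> v = ?y" using touch e by blast
      have "z \<notin> set vs"
      proof
        assume "z \<in> set vs"
        then have "z = ?x \<or> z = ?y" using touch[OF e(1)] z by blast
        then show False using v noloop[of v] False e(1) z by (auto simp: insert_commute)
      qed
      then show ?thesis using v extl[of z] extr[of z] e(1) z by auto
    qed
    obtain L F1 where L: "L = [] \<and> F1 = F \<and> (\<forall>b. {?x, b} \<notin># F) \<or> (\<exists>b. L = [b] \<and> b \<in> ?B \<and> F = add_mset {?x, b} F1)"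
    proof (cases "\<exists>b. {?x, b} \<in># F")
      case True
      then obtain b where b: "{?x, b} \<in># F" by blast
      have "b \<notin> set vs" using touch[OF b, of b] noloop[of ?x] False b by (auto simp: insert_commute)
      then have "b \<in> ?B" using extl[OF b] by blast
      then show ?thesis using that[of "[b]" "F - {#{?x, b}#}"] b by auto
    qed (use that in blast)
    have F1F: "F1 \<subseteq># F" using L by auto
    \<comment> \<open>The edge for \<open>R\<close> is taken from \<open>F1\<close> and not from
      \<open>F\<close>: on a one-vertex path both ends coincide, and one edge has already been used
      for \<open>L\<close>.\<close>
    obtain R E where R: "R = [] \<and> E = F1 \<and> (\<forall>b. {?y, b} \<notin># F1) \<or> (\<exists>b. R = [b] \<and> b \<in> ?B \<and> F1 = add_mset {?y, b} E)"
    proof (cases "\<exists>b. {?y, b} \<in># F1")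
      case True
      then obtain b where b1: "{?y, b} \<in># F1" by blast
      then have b: "{?y, b} \<in># F" using F1F by (rule mset_subset_eqD[rotated])
      have "b \<notin> set vs" using touch[OF b, of b] noloop[of ?y] False b by (auto simp: insert_commute)
      then have "b \<in> ?B" using extr[OF b] by blast
      then show ?thesis using that[of "[b]" "F1 - {#{?y, b}#}"] b1 by auto
    qed (use that in blast)
    have EF1: "E \<subseteq># F1" using R by auto
    have nt1: False if e: "{?x, b} \<in># E" for b
    proof -
      obtain E' where E': "E = add_mset {?x, b} E'" using e by (metis multi_member_split)
      have eF1: "{?x, b} \<in># F1" using e EF1 by (rule mset_subset_eqD[rotated])
      then have "{?x, b} \<in># F" using F1F by (rule mset_subset_eqD[rotated])
      then obtain b0 where b0: "F = add_mset {?x, b0} F1" using L by blast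
      obtain F2 where "F1 = add_mset {?x, b} F2" using eF1 by (metis multi_member_split)
      then have "mdeg F ?x \<ge> 2" by (simp add: b0)
      then have xx: "?x = ?y" using degF[OF xy(1)] by (cases "?x = ?y") auto
      then obtain b1 where "F1 = add_mset {?y, b1} E" using R eF1 by force
      then have "mdeg F ?x \<ge> 3" using xx by (simp add: b0 E')
      then show False using degF[OF xy(1)] by (cases "?x = ?y") auto
    qed
    have nt2: False if e: "{?y, b} \<in># E" for b
    proof -
      obtain E' where E': "E = add_mset {?y, b} E'" using e by (metis multi_member_split)
      have eF1: "{?y, b} \<in># F1" using e EF1 by (rule mset_subset_eqD[rotated])
      then obtain b1 where "F1 = add_mset {?y, b1} E" using R by blast
      then have "mdeg F1 ?y \<ge> 2" by (simp add: E')
      moreover have "mdeg F ?y \<ge> mdeg F1 ?y" using L by auto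
      ultimately have "mdeg F ?y \<ge> 2" by simp
      then have "?x = ?y" using degF[OF xy(2)] by (cases "?x = ?y") auto
      then show False using nt1[of b] e by simp
    qed
    have EA: "e \<subseteq> verts G - set vs" if e: "e \<in># E" for e
    proof -
      have eF: "e \<in># F" using mset_subset_eqD[OF EF1 e] F1F by (rule mset_subset_eqD[rotated])
      have "v \<notin> set vs" if "v \<in> e" for v using out[OF eF that] nt1 nt2 e by blast
      then show ?thesis using weighted_graphD(3)[OF G, of e] eF by (auto simp: eG)
    qed
    have LR: "length L \<le> 1" "length R \<le> 1" "set L \<union> set R \<subseteq> ?B" using L R by auto
    have "F = (if L = [] then {#} else {#{hd L, ?x}#}) + F1" using L by (auto simp: insert_commute)
    moreover have "F1 = (if R = [] then {#} else {#{?y, hd R}#}) + E" using R by auto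
    ultimately have "edges G = path_edges (L @ vs @ R) + E"
      unfolding path_edges_ends[OF LR(1,2) ne] eG by (simp add: ac_simps)
    moreover have "set L \<union> set R \<subseteq> verts G - set vs" using LR(3) sub(2) by (auto simp: branching_points_def)
    ultimately have "seg G (verts G - set vs) L vs R E"
      unfolding seg_def using G sub(1) d ne EA LR by auto
    then show ?thesis using uv by blast
  qed
qed

text \<open>The edges meeting \<open>us\<close> are exactly those of
  \<open>path_edges (L2 @ us @ R2)\<close>. None of them belongs to the path of \<open>vs\<close>,
  which runs in \<open>vs\<close> and branching points only. So they all lie in \<open>E\<close>,
  which the transformation leaves in place; the weights survive because \<open>us\<close> lies in
  \<open>A\<close> and avoids branching points.\<close>

lemma seg_persist:
  assumes s: "seg G A L vs R E" and s': "seg G' A L vs' R E" and k: "keeps A G G'"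
    and t: "seg G A2 L2 us R2 E2" and disj: "set us \<inter> set vs = {}"
  shows "\<exists>A' E'. seg G' A' L2 us R2 E' \<and> map (weight G') us = map (weight G) us"
proof -
  note sD = segD[OF s] and s'D = segD[OF s'] and tD = segD[OF t]
  let ?T = "\<lambda>e. e \<inter> set us \<noteq> {}"
  have B: "branching_points G' = branching_points G" using k by (simp add: keeps_def)
  have usB: "set us \<inter> branching_points G = {}" using seg_not_branching[OF t] by blast
  have usA: "set us \<subseteq> A" using tD(2) sD(2) disj by blast
  have 1: "?T e" if e: "e \<in># path_edges (L2 @ us @ R2)" for e
  proof -
    have "e \<noteq> {}" using weighted_graphD(4)[OF tD(1), of e] e by (simp add: tD(6))
    then show ?thesis using e path_edges_subset[of e us] hd_in_set[OF tD(5)] last_in_set[OF tD(5)]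
      unfolding path_edges_ends[OF tD(12,13,5)] by (auto split: if_splits)
  qed
  have 2: "\<not> ?T e" if "e \<in># E2" for e using tD(3) tD(7)[OF that] by blast
  have 3: "\<not> ?T e" if "e \<in># path_edges (L @ xs @ R)" "set xs \<inter> set us = {}" for e xs
  proof -
    have "e \<subseteq> set L \<union> set xs \<union> set R" using path_edges_subset[OF that(1)] by auto
    then show ?thesis using that(2) sD(10,11) usB by blast
  qed
  have "filter_mset ?T (path_edges (L2 @ us @ R2)) = path_edges (L2 @ us @ R2)"
    using 1 by (subst filter_mset_eq_conv) auto
  moreover have "filter_mset ?T E2 = {#}" using 2 by simp
  ultimately have "filter_mset ?T (edges G) = path_edges (L2 @ us @ R2)" by (simp only: tD(6) filter_union_mset) simp
  moreover have "filter_mset ?T (edges G) = filter_mset ?T E"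
    using 3[of _ vs] disj by (simp add: sD(6) Int_commute)
  ultimately have E: "E = path_edges (L2 @ us @ R2) + filter_mset (\<lambda>e. \<not> ?T e) E"
    using multiset_partition[of E ?T] by simp
  define E' where "E' = path_edges (L @ vs' @ R) + filter_mset (\<lambda>e. \<not> ?T e) E"
  have vd: "set vs' \<inter> set us = {}" using s'D(3) usA by blast
  have "edges G' = path_edges (L2 @ us @ R2) + E'"
    unfolding s'D(6) E'_def by (subst E) (simp add: ac_simps)
  moreover have "e \<subseteq> verts G' - set us" if "e \<in># E'" for e
  proof -
    have "e \<in># edges G'" using that by (auto simp: E'_def s'D(6))
    then have "e \<subseteq> verts G'" by (rule weighted_graphD(3)[OF s'D(1)])
    moreover have "\<not> ?T e" using that 3[of e vs'] vd by (auto simp: E'_def)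
    ultimately show ?thesis by blast
  qed
  moreover have "set L2 \<union> set R2 \<subseteq> (verts G' - set us) \<inter> branching_points G'"
    using tD(10,11) usB unfolding B[symmetric] by (auto simp: branching_points_def)
  moreover have "set us \<subseteq> verts G'" using usA s'D(2) by blast
  ultimately have "seg G' (verts G' - set us) L2 us R2 E'"
    unfolding seg_def using s'D(1) tD(4,5,12,13) by auto
  moreover have "map (weight G') us = map (weight G) us"
    using k usA usB by (auto simp: keeps_def)
  ultimately show ?thesis by blast
qed

text \<open>\<open>Q\<close> is told which ends are joined to a branching point, because this
  decides whether a step beyond the end is inner.\<close>

definition seg_at :: "(bool \<Rightarrow> bool \<Rightarrow> int list \<Rightarrow> bool) \<Rightarrow> 'v wgraph \<Rightarrow> 'v \<Rightarrow> bool" where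
  "seg_at Q G u \<longleftrightarrow> (\<exists>A L vs R E. seg G A L vs R E \<and> u \<in> set vs \<and> Q (L \<noteq> []) (R \<noteq> []) (map (weight G) vs))"

lemma seg_at_persist:
  assumes s: "seg G A L vs R E" and s': "seg G' A L vs' R E" and k: "keeps A G G'"
    and u: "seg_at Q G u" "u \<notin> set vs"
  shows "seg_at Q G' u"
proof -
  obtain A2 L2 us R2 E2 where t: "seg G A2 L2 us R2 E2" "u \<in> set us" "Q (L2 \<noteq> []) (R2 \<noteq> []) (map (weight G) us)"
    using u(1) unfolding seg_at_def by blast
  \<comment> \<open>By \<open>seg_component\<close>, segments sharing a vertex coincide as sets, so
    a segment through \<open>u\<close> is disjoint from \<open>vs\<close>.\<close>
  have "set us = set vs" if "x \<in> set us" "x \<in> set vs" for x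
    using seg_component(2)[OF s that(2)] seg_component(2)[OF t(1) that(1)] by simp
  then have "set us \<inter> set vs = {}" using u(2) t(2) by blast
  from seg_persist[OF s s' k t(1) this] show ?thesis unfolding seg_at_def using t(2,3) by metis
qed

text \<open>\<open>Q\<close> expresses that a segment can be made good, and it has to hold again
  after every round. The induction counts vertices in bad segments: the processed segment
  contributes at least \<open>u\<close>, its new vertices are all good, and the other segments keep
  their status.\<close>

lemma process_segments:
  assumes "weighted_graph G" and "\<forall>u\<in>verts G - branching_points G. seg_at Q G u"
    and step: "\<And>G A L vs R E. seg G A L vs R E \<Longrightarrow> Q (L \<noteq> []) (R \<noteq> []) (map (weight G) vs) \<Longrightarrow>
      \<exists>G' vs'. T\<^sup>*\<^sup>* G G' \<and> seg G' A L vs' R E \<and> good (map (weight G') vs') \<and> keeps A G G'"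
    and good: "\<And>pl pr ws. good ws \<Longrightarrow> Q pl pr ws"
  shows "\<exists>G'. T\<^sup>*\<^sup>* G G' \<and> weighted_graph G' \<and> (\<forall>u\<in>verts G' - branching_points G'. seg_at (\<lambda>_ _. good) G' u)"
  using assms(1,2)
proof (induction "card {u \<in> verts G - branching_points G. \<not> seg_at (\<lambda>_ _. good) G u}" arbitrary: G rule: less_induct)
  case (less G)
  let ?bad = "\<lambda>G. {u \<in> verts G - branching_points G. \<not> seg_at (\<lambda>_ _. good) G u}"
  show ?case
  proof (cases "?bad G = {}")
    case True
    then show ?thesis using less(2) by blast
  next
    case False
    then obtain u where u: "u \<in> ?bad G" by blast
    then have "seg_at Q G u" using less(3) by blast
    then obtain A L vs R E where s: "seg G A L vs R E" "u \<in> set vs" "Q (L \<noteq> []) (R \<noteq> []) (map (weight G) vs)"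
      unfolding seg_at_def by blast
    obtain G' vs' where G': "T\<^sup>*\<^sup>* G G'" "seg G' A L vs' R E" "good (map (weight G') vs')" "keeps A G G'"
      using step[OF s(1,3)] by blast
    have B: "branching_points G' = branching_points G" using G'(4) by (simp add: keeps_def)
    note sD = segD[OF s(1)] and s'D = segD[OF G'(2)]
    have new: "seg_at (\<lambda>_ _. good) G' v" if "v \<in> set vs'" for v
      unfolding seg_at_def using G'(2,3) that by blast
    have old: "v \<in> A" "v \<in> verts G" "v \<notin> set vs" if "v \<in> verts G'" "v \<notin> set vs'" for v
      using that sD(2,3) s'D(2) by auto
    have pers: "seg_at P G' v" if "seg_at P G v" "v \<in> verts G'" "v \<notin> set vs'" for P v
      using seg_at_persist[OF s(1) G'(2,4) that(1) old(3)[OF that(2,3)]] .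
    have "?bad G' \<subseteq> ?bad G - {u}"
      using new pers old s(2) B by blast
    moreover have fin: "finite (?bad G)" using weighted_graphD(1)[OF less(2)] by simp
    ultimately have "card (?bad G') < card (?bad G)"
      using u by (metis (no_types, lifting) card_Diff1_less card_mono finite_Diff le_less_trans)
    moreover have "\<forall>v\<in>verts G' - branching_points G'. seg_at Q G' v"
    proof
      fix v assume v: "v \<in> verts G' - branching_points G'"
      show "seg_at Q G' v"
      proof (cases "v \<in> set vs'")
        case True
        then show ?thesis using G'(2,3) good unfolding seg_at_def by blast
      next
        case F: False
        then show ?thesis using pers[of Q v] less(3) old[of v] v B by blast
      qed
    qed
    ultimately obtain G'' where "T\<^sup>*\<^sup>* G' G''" "weighted_graph G''"
      "\<forall>u\<in>verts G'' - branching_points G''. seg_at (\<lambda>_ _. good) G'' u"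
      using less(1)[of G'] s'D(1) by blast
    then show ?thesis using rtranclp_trans[OF G'(1)] by blast
  qed
qed

text \<open>Without branching points both ends of a segment are free, and an end vertex then has
  degree at most 1. This selects the non-circular clause of \<open>standard_graph\<close>.\<close>

lemma seg_at_not_circular:
  assumes G: "weighted_graph G" and s: "\<forall>u\<in>verts G - branching_points G. seg_at Q G u"
  shows "\<not> circular_graph G"
proof
  assume "circular_graph G"
  then have d: "deg G v = 2" if "v \<in> verts G" for v using that by (simp add: circular_graph_def)
  then have B: "branching_points G = {}" by (auto simp: branching_points_def)
  obtain u where "u \<in> verts G" using weighted_graphD(2)[OF G] by blast
  then obtain A L vs R E where t: "seg G A L vs R E" using s B unfolding seg_at_def by blast
  note tD = segD[OF t]
  have "L = []" using tD(10) B by simp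
  then have "deg G (hd vs) \<noteq> 2" using seg_deg[OF t, of "hd vs"] tD(5) by auto
  then show False using d[of "hd vs"] tD(2,5) by simp
qed

section \<open>Circular graphs and minimality\<close>

lemma circle_on_circular:
  assumes c: "circle_on G cs"
  shows "circular_graph G"
proof -
  have ne: "cs \<noteq> []" using c by (simp add: circle_on_def)
  have "deg G v = 2" if "v \<in> verts G" for v
    using c that mdeg_path[of cs v] path_edges_snoc[OF ne, of "hd cs"] by (auto simp: circle_on_def deg_mdeg)
  then show ?thesis using c by (simp add: circular_graph_def circle_on_def)
qed

lemma circular_segments:
  assumes "circular_graph G" "S \<in> segments G"
  shows "S = G"
proof -
  have G: "weighted_graph G" and B: "branching_points G = {}"
    using assms(1) by (auto simp: circular_graph_def branching_points_def)
  have d: "delete_verts G {} = G" by (simp add: delete_verts_def)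
  obtain u where "u \<in> verts G" "S = component G u" using assms(2) by (auto simp: segments_def components_def B d)
  moreover from this have "{v \<in> verts G. \<not> (adjacent G)\<^sup>*\<^sup>* u v} = {}" using weighted_graphD(5)[OF G] by blast
  ultimately show ?thesis by (simp only: component_def d)
qed

text \<open>With both ends free no edge leads from \<open>vs\<close> to \<open>A\<close>, so
  connectedness forces \<open>A\<close> and \<open>E\<close> to be empty.\<close>

lemma seg_isolated:
  assumes s: "seg G A [] vs [] E"
  shows "is_chain G (map (weight G) vs)"
proof -
  note sD = segD[OF s]
  have u: "hd vs \<in> set vs" using sD(5) by simp
  have "v \<in> set vs" if "(adjacent G)\<^sup>*\<^sup>* (hd vs) v" for v
    using that
  proof (induction rule: rtranclp_induct)
    case (step y z)
    then have "{y, z} \<in># path_edges vs \<or> {y, z} \<in># E" using sD(6) by (auto simp: adjacent_def)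
    then show ?case using path_edges_subset[of "{y, z}" vs] sD(7)[of "{y, z}"] sD(3) step by auto
  qed (use u in simp)
  then have A: "A = {}" using weighted_graphD(5)[OF sD(1), of "hd vs"] sD(2,3) u by blast
  have "E = {#}"
  proof (rule ccontr)
    assume "E \<noteq> {#}"
    then obtain e where "e \<in># E" by blast
    then show False using sD(7)[of e] A weighted_graphD(4)[OF sD(1), of e] sD(6) by auto
  qed
  then show ?thesis unfolding is_chain_def mset_path using sD A by auto
qed

lemma is_chain_rev: "is_chain G ws \<Longrightarrow> is_chain G (rev ws)"
  unfolding is_chain_def mset_path by (metis path_edges_rev distinct_rev set_rev rev_is_Nil_conv rev_map)

text \<open>A vertex of weight -1 is contracted as an inner vertex of the path or, after reversing
  if necessary, as an end vertex. Its neighbour may be a branching point, so the blowdown need not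
  be admissible; to contradict minimality this suffices.\<close>

lemma path_blowdown:
  assumes G: "weighted_graph G" and eG: "edges G = path_edges (p @ [c] @ q) + E"
    and c: "c \<notin> set p" "c \<notin> set q" and E: "\<And>e. e \<in># E \<Longrightarrow> c \<notin> e" and w: "weight G c = -1"
    and ne: "p \<noteq> [] \<or> q \<noteq> []"
  shows "\<exists>G'. blowdown G G'"
proof -
  have *: "\<exists>G'. blowdown G G'" if "edges G = path_edges (c # b # q) + E" "c \<notin> set (b # q)" for b q
  proof -
    have e: "edges G = add_mset {b, c} (path_edges (b # q) + E)" using that(1) by (simp add: insert_commute)
    have nE: "c \<notin> e" if "e \<in># path_edges (b # q) + E" for e
      using that path_edges_subset[of e "b # q"] E \<open>c \<notin> set (b # q)\<close> by auto
    have "b \<noteq> c" using that(2) by auto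
    from outer_down[OF G e nE this w] show ?thesis by metis
  qed
  show ?thesis
  proof (cases p rule: rev_cases)
    case Nil
    then obtain b q' where "q = b # q'" using ne by (cases q) auto
    then show ?thesis using *[of b q'] eG c Nil by simp
  next
    case (snoc p' a)
    show ?thesis
    proof (cases q)
      case Nil
      then have "edges G = path_edges (c # a # rev p') + E"
        using eG snoc path_edges_rev[of "c # a # rev p'"] by simp
      then show ?thesis using *[of a "rev p'"] c snoc by simp
    next
      case (Cons b q')
      have e: "edges G = add_mset {a, c} (add_mset {c, b} (path_edges (p' @ [a]) + path_edges (b # q') + E))"
        using eG path_edges_mid3[of p' a c b q'] snoc Cons by simp
      have nE: "c \<notin> e" if "e \<in># path_edges (p' @ [a]) + path_edges (b # q') + E" for e
        using that path_edges_subset[of e "b # q'"] path_edges_subset[of e "p' @ [a]"] E c snoc Cons by auto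
      have "a \<noteq> c" "b \<noteq> c" using c snoc Cons by auto
      from inner_down[OF G e nE this w] show ?thesis by metis
    qed
  qed
qed

lemma minimal_seg_weights:
  assumes m: "minimal_graph G" and s: "seg G A L vs R E"
  shows "-1 \<notin> set (map (weight G) vs)"
proof
  note sD = segD[OF s]
  assume "-1 \<in> set (map (weight G) vs)"
  then obtain c where c: "c \<in> set vs" "weight G c = -1" by auto
  then obtain u w where vs: "vs = u @ [c] @ w" by (metis append_Cons append_Nil in_set_conv_decomp)
  have cA: "c \<notin> A" using c sD(3) by blast
  show False
  proof (cases "L @ u \<noteq> [] \<or> w @ R \<noteq> []")
    case True
    have e: "edges G = path_edges ((L @ u) @ [c] @ (w @ R)) + E" using sD(6) vs by simp
    have "\<exists>G'. blowdown G G'"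
      by (rule path_blowdown[OF sD(1) e _ _ _ c(2) True])
        (use sD(4,8,9) sD(7) cA vs in \<open>auto\<close>)
    then show False using m by (simp add: minimal_graph_def)
  next
    case False
    \<comment> \<open>Here the graph is a single vertex of weight -1, and minimality also forbids
      its blowdown to the empty graph.\<close>
    then have "is_chain G [-1]" using seg_isolated[of G A vs E] s vs c(2) by simp
    then have "blowdown G \<lparr>verts = {}, edges = {#}, weight = weight G\<rparr>" by (simp add: blowdown_def)
    then show False using m unfolding minimal_graph_def by blast
  qed
qed

section \<open>From normalized weights to standard graphs\<close>

lemma circle_std_standard:
  assumes "circle_on G cs" "circle_std (map (weight G) cs)"
  shows "standard_circular G"
proof -
  have "is_circle G (map (weight G) cs)"
    using assms(1) is_circle_circle_on[of G] by (auto simp: circle_on_def)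
  then show ?thesis using assms(2) unfolding circle_std_def standard_circular_def by metis
qed

lemma semistd_chain:
  assumes "is_chain G ws" "semistd ws \<or> semistd (rev ws)"
  shows "semistandard_chain G"
  using assms is_chain_rev[OF assms(1)] unfolding semistd_def semistandard_chain_def by metis

lemma std_chain:
  assumes "is_chain G ws" "std ws \<or> std (rev ws)"
  shows "standard_chain G"
  using assms is_chain_rev[OF assms(1)] unfolding std_def standard_chain_def by metis

lemma segments_at:
  assumes s: "\<forall>u\<in>verts G - branching_points G. seg_at (\<lambda>_ _. good) G u" and S: "S \<in> segments G"
  shows "\<exists>ws. is_chain S ws \<and> good ws"
proof -
  obtain u where u: "u \<in> verts G - branching_points G" "S = component (delete_verts G (branching_points G)) u"
    using S by (auto simp: segments_def components_def delete_verts_def)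
  then obtain A L vs R E where "seg G A L vs R E" "u \<in> set vs" "good (map (weight G) vs)"
    using s unfolding seg_at_def by blast
  then show ?thesis using seg_component(1)[of G A L vs R E u] unfolding u(2) by blast
qed

text \<open>A circle has no free ends, so every lifted step is inner and one transformation serves
  both claims.\<close>

lemma circular_case:
  fixes G :: "'v::infinite wgraph"
  assumes "circle_on G cs"
  shows "\<exists>G'. inner_step\<^sup>*\<^sup>* G G' \<and> semistandard_graph G' \<and> standard_graph G'"
proof -
  have "map (weight G) cs \<noteq> []" using assms by (simp add: circle_on_def)
  then obtain ws where ws: "circle_step\<^sup>*\<^sup>* (map (weight G) cs) ws" "circle_std ws"
    using circle_steps_std by blast
  obtain G' cs' where G': "inner_step\<^sup>*\<^sup>* G G'" "circle_on G' cs'" "map (weight G') cs' = ws"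
    using circle_steps_lift[OF ws(1) assms refl] by blast
  have w: "weighted_graph G'" using G'(2) by (simp add: circle_on_def)
  have c: "circular_graph G'" using circle_on_circular G'(2) by blast
  have st: "standard_circular G'" using circle_std_standard G'(2,3) ws(2) by blast
  have "semistandard_graph G'" "standard_graph G'"
    unfolding semistandard_graph_def standard_graph_def using w c st circular_segments[OF c] by auto
  with G'(1) show ?thesis by blast
qed

lemma minimal_segment_cases:
  assumes m: "minimal_graph G" and s: "seg G A L vs R E"
  obtains "\<forall>w\<in>set (map (weight G) vs). w \<le> -2" | b where "b \<in> set (map (weight G) vs)" "b \<ge> 0"
proof (cases "\<forall>w\<in>set (map (weight G) vs). w \<le> -2")
  case False
  then obtain b where b: "b \<in> set (map (weight G) vs)" "b > -2" by force
  then have "b \<noteq> -1" using minimal_seg_weights[OF m s] by blast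
  then show ?thesis using that(2)[OF b(1)] b(2) by simp
qed (rule that(1))

lemma inner_steps_admissible: "inner_step\<^sup>*\<^sup>* G G' \<Longrightarrow> admissible_step\<^sup>*\<^sup>* G G'"
  using rtranclp_mono[of inner_step admissible_step] inner_step_admissible by (metis predicate2I predicate2D)

theorem theorem2p15:
  fixes \<Gamma> :: "'v::infinite wgraph"
  assumes "weighted_graph \<Gamma>" and "minimal_graph \<Gamma>"
  shows "((\<nexists>w. is_chain \<Gamma> [w]) \<longrightarrow>
            (\<exists>\<Gamma>'. inner_transformation \<Gamma> \<Gamma>' \<and> semistandard_graph \<Gamma>'))
         \<and> (\<exists>\<Gamma>'. admissible_transformation \<Gamma> \<Gamma>' \<and> standard_graph \<Gamma>')"
proof (cases "\<exists>cs. circle_on \<Gamma> cs")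
  case True
  then show ?thesis unfolding inner_transformation_def admissible_transformation_def
    using circular_case inner_steps_admissible by metis
next
  case False
  then have segs: "\<exists>A L vs R E. seg \<Gamma> A L vs R E \<and> u \<in> set vs" if "u \<in> verts \<Gamma> - branching_points \<Gamma>" for u
    using seg_or_circle[OF assms(1)] that by blast
  let ?a = "\<lambda>ws. semistd ws \<or> semistd (rev ws)" and ?b = "\<lambda>ws. std ws \<or> std (rev ws)"
  have a: "\<exists>\<Gamma>'. inner_transformation \<Gamma> \<Gamma>' \<and> semistandard_graph \<Gamma>'" if np: "\<nexists>w. is_chain \<Gamma> [w]"
  proof -
    \<comment> \<open>The flags will be \<open>L \<noteq> []\<close> and
      \<open>R \<noteq> []\<close>, so blowups beyond an end occur only on edges to branching points
      and all steps lift to inner ones.\<close>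
    let ?Q = "\<lambda>pl pr ws. \<exists>t. (chain_step pl pr)\<^sup>*\<^sup>* ws t \<and> ?a t"
    have Q: "\<forall>u\<in>verts \<Gamma> - branching_points \<Gamma>. seg_at ?Q \<Gamma> u"
    proof
      fix u assume "u \<in> verts \<Gamma> - branching_points \<Gamma>"
      then obtain A L vs R E where s: "seg \<Gamma> A L vs R E" "u \<in> set vs" using segs by blast
      from assms(2) s(1) have "?Q (L \<noteq> []) (R \<noteq> []) (map (weight \<Gamma>) vs)"
      proof (cases rule: minimal_segment_cases)
        case 1
        then have "semistd (map (weight \<Gamma>) vs)" unfolding semistd_def zeros_def
          by (metis append_Nil replicate_0)
        then show ?thesis by blast
      next
        case (2 b)
        \<comment> \<open>The only segment without any edge to blow up is an isolated vertex, and
          then the graph is a point.\<close>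
        have "length (map (weight \<Gamma>) vs) \<ge> 2 \<or> L \<noteq> [] \<or> R \<noteq> []"
        proof (rule ccontr)
          assume *: "\<not> ?thesis"
          then have "is_chain \<Gamma> (map (weight \<Gamma>) vs)" using seg_isolated s(1) by blast
          moreover have "length vs < 2" "0 < length vs" using * segD(5)[OF s(1)] by auto
          then obtain v where "vs = [v]" by (cases vs) (auto simp: less_Suc_eq)
          ultimately show False using np by auto
        qed
        from chain_semistd[OF 2 this] show ?thesis .
      qed
      then show "seg_at ?Q \<Gamma> u" unfolding seg_at_def using s by blast
    qed
    have "\<exists>\<Gamma>'. inner_step\<^sup>*\<^sup>* \<Gamma> \<Gamma>' \<and> weighted_graph \<Gamma>' \<and>
      (\<forall>u\<in>verts \<Gamma>' - branching_points \<Gamma>'. seg_at (\<lambda>_ _. ?a) \<Gamma>' u)"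
    proof (rule process_segments[OF assms(1) Q])
      fix G :: "'v wgraph" and A L vs R E
      assume s: "seg G A L vs R E" and "?Q (L \<noteq> []) (R \<noteq> []) (map (weight G) vs)"
      then obtain t where t: "(chain_step (L \<noteq> []) (R \<noteq> []))\<^sup>*\<^sup>* (map (weight G) vs) t" "?a t" by blast
      from seg_chain_steps[OF t(1) s refl, of inner_step] t(2)
      show "\<exists>G' vs'. inner_step\<^sup>*\<^sup>* G G' \<and> seg G' A L vs' R E \<and> ?a (map (weight G') vs') \<and> keeps A G G'"
        by metis
    qed blast
    then obtain \<Gamma>' where G': "inner_step\<^sup>*\<^sup>* \<Gamma> \<Gamma>'" "weighted_graph \<Gamma>'"
      "\<forall>u\<in>verts \<Gamma>' - branching_points \<Gamma>'. seg_at (\<lambda>_ _. ?a) \<Gamma>' u" by blast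
    have "semistandard_chain S" if "S \<in> segments \<Gamma>'" for S
      using segments_at[OF G'(3) that] semistd_chain by blast
    then have "semistandard_graph \<Gamma>'" using G'(2) by (simp add: semistandard_graph_def)
    then show ?thesis using G'(1) unfolding inner_transformation_def by blast
  qed
  have b: "\<exists>\<Gamma>'. admissible_transformation \<Gamma> \<Gamma>' \<and> standard_graph \<Gamma>'"
  proof -
    \<comment> \<open>Both flags are set, as outer blowups at free ends are admissible too.\<close>
    let ?Q = "\<lambda>_ _ ws. \<exists>t. (chain_step True True)\<^sup>*\<^sup>* ws t \<and> ?b t"
    have Q: "\<forall>u\<in>verts \<Gamma> - branching_points \<Gamma>. seg_at ?Q \<Gamma> u"
    proof
      fix u assume "u \<in> verts \<Gamma> - branching_points \<Gamma>"
      then obtain A L vs R E where s: "seg \<Gamma> A L vs R E" "u \<in> set vs" using segs by blast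
      from assms(2) s(1) have "\<exists>t. (chain_step True True)\<^sup>*\<^sup>* (map (weight \<Gamma>) vs) t \<and> ?b t"
      proof (cases rule: minimal_segment_cases)
        case 1
        then have "std (map (weight \<Gamma>) vs)" unfolding std_def zeros_def
          by (metis append_Nil mult_0_right replicate_0)
        then show ?thesis by blast
      next
        case (2 b)
        from chain_std[OF this] show ?thesis .
      qed
      then show "seg_at ?Q \<Gamma> u" unfolding seg_at_def using s by blast
    qed
    have "\<exists>\<Gamma>'. admissible_step\<^sup>*\<^sup>* \<Gamma> \<Gamma>' \<and> weighted_graph \<Gamma>' \<and>
      (\<forall>u\<in>verts \<Gamma>' - branching_points \<Gamma>'. seg_at (\<lambda>_ _. ?b) \<Gamma>' u)"
    proof (rule process_segments[OF assms(1) Q])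
      fix G :: "'v wgraph" and A L vs R E
      assume s: "seg G A L vs R E" and "\<exists>t. (chain_step True True)\<^sup>*\<^sup>* (map (weight G) vs) t \<and> ?b t"
      then obtain t where t: "(chain_step True True)\<^sup>*\<^sup>* (map (weight G) vs) t" "?b t" by blast
      from seg_chain_steps[OF t(1) s refl, of admissible_step] t(2)
      show "\<exists>G' vs'. admissible_step\<^sup>*\<^sup>* G G' \<and> seg G' A L vs' R E \<and> ?b (map (weight G') vs') \<and> keeps A G G'"
        by metis
    qed blast
    then obtain \<Gamma>' where G': "admissible_step\<^sup>*\<^sup>* \<Gamma> \<Gamma>'" "weighted_graph \<Gamma>'"
      "\<forall>u\<in>verts \<Gamma>' - branching_points \<Gamma>'. seg_at (\<lambda>_ _. ?b) \<Gamma>' u" by blast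
    have "standard_chain S" if "S \<in> segments \<Gamma>'" for S
      using segments_at[OF G'(3) that] std_chain by blast
    then have "standard_graph \<Gamma>'"
      using G'(2) seg_at_not_circular[OF G'(2,3)] by (simp add: standard_graph_def)
    then show ?thesis using G'(1) unfolding admissible_transformation_def by blast
  qed
  show ?thesis using a b by blast
qed

end
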